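(* Let $m_1,\dots,m_N>0$ and let $q(t)=(q_1(t),\dots,q_N(t))$, $q_a(t)\in\mathbb{R}^d$, be a total collision solution of the Newtonian $N$-body problem in $d$-dimensional Euclidean space $\mathbb{R}^d$ with these masses. If the limiting shape of the solution is collinear, then the solution is collinear: there is a fixed line in $\mathbb{R}^d$ containing all $N$ bodies at every instant.
   Context: Setting. The masses are $m_1,\dots,m_N>0$. A configuration is $q=(q_1,\dots,q_N)$ with $q_a\in\mathbb{R}^d$ and center of mass at the origin, $\sum_a m_aq_a=0$; the space of these is $\mathbb{E}_0$, with mass inner product $\langle q,y\rangle=\sum_a m_a\,q_a\cdot y_a$ and norm $\|q\|=\sqrt{\langle q,q\rangle}$. Let $U(q)=\sum_{a<b}\frac{m_am_b}{|q_a-q_b|}$ (the negative of the usual potential). Newton's equations are $\ddot q=\nabla U(q)$, the gradient being taken with respect to the mass inner product, i.e. $m_a\ddot q_a=\partial U/\partial q_a$. A solution is a collision-free solution in $\mathbb{E}_0$. Total collision solution: a solution $q:[t_0,T)\to\mathbb{E}_0$, $T<\infty$, with $q(t)\to 0$ as $t\to T^-$. Central configurations and limiting shape: let $\mathbb{S}=\{s\in\mathbb{E}_0:\|s\|=1\}$. A normalized central configuration (CC) is a critical point of the restriction of $U$ to the collision-free part of $\mathbb{S}$. The group $G=SO(d)$ acts on configurations by $gq=(gq_1,\dots,gq_N)$. A total collision solution $q(t)$ has limiting shape $s_0$, where $s_0$ is a normalized CC considered up to rotation, if the distance from $q(t)/\|q(t)\|$ to the orbit $Gs_0$ tends to $0$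 as $t\to T^-$. A configuration is called collinear if the linear span of $q_1,\dots,q_N$ in $\mathbb{R}^d$ is 1-dimensional; the limiting shape is called collinear if $s_0$ is. *)

theory Defs
  imports "HOL-Analysis.Analysis"
begin

text \<open>
  Configurations of \<open>N\<close> bodies in \<open>d\<close>-dimensional space are vectors \<open>q :: real^'d^'n\<close> with
  \<open>N = CARD('n)\<close> and \<open>d = CARD('d)\<close>; the position of body \<open>a\<close> is \<open>q $ a\<close>. The linear order
  on the type of bodies serves only to write sums over \<open>a < b\<close>.
\<close>

definition mass_inner :: "('n \<Rightarrow> real) \<Rightarrow> real^'d^'n \<Rightarrow> real^'d^'n \<Rightarrow> real" where
  "mass_inner m q y = (\<Sum>a\<in>UNIV. m a * (q $ a \<bullet> y $ a))"

definition mass_norm :: "('n \<Rightarrow> real) \<Rightarrow> real^'d^'n \<Rightarrow> real" where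
  "mass_norm m q = sqrt (mass_inner m q q)"

definition centered :: "('n \<Rightarrow> real) \<Rightarrow> (real^'d^'n) set" where
  "centered m = {q. (\<Sum>a\<in>UNIV. m a *\<^sub>R q $ a) = 0}"

definition collision_free :: "real^'d^'n \<Rightarrow> bool" where
  "collision_free q \<longleftrightarrow> (\<forall>a b. a \<noteq> b \<longrightarrow> q $ a \<noteq> q $ b)"

definition newton_U :: "('n \<Rightarrow> real) \<Rightarrow> real^'d^('n::{finite,linorder}) \<Rightarrow> real" where
  "newton_U m q = (\<Sum>(a, b)\<in>{(a, b). a < b}. m a * m b / norm (q $ a - q $ b))"

definition has_mass_gradient ::
    "('n \<Rightarrow> real) \<Rightarrow> (real^'d^'n \<Rightarrow> real) \<Rightarrow> real^'d^'n \<Rightarrow> real^'d^'n \<Rightarrow> bool" where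
  "has_mass_gradient m f g q \<longleftrightarrow> (f has_derivative mass_inner m g) (at q)"

text \<open>
  Derivatives are taken within \<open>I\<close>, hence are one-sided at an endpoint belonging to \<open>I\<close>;
  values of \<open>q\<close> outside \<open>I\<close> play no role.
\<close>

definition newton_solution ::
    "('n \<Rightarrow> real) \<Rightarrow> real set \<Rightarrow> (real \<Rightarrow> real^'d^('n::{finite,linorder})) \<Rightarrow> bool" where
  "newton_solution m I q \<longleftrightarrow>
     (\<forall>t\<in>I. q t \<in> centered m \<and> collision_free (q t)) \<and>
     (\<exists>v. \<forall>t\<in>I. (q has_vector_derivative v t) (at t within I) \<and>
        (\<exists>g. has_mass_gradient m (newton_U m) g (q t) \<and>
             (v has_vector_derivative g) (at t within I)))"

definition total_collision_solution ::
    "('n \<Rightarrow> real) \<Rightarrow> real \<Rightarrow> real \<Rightarrow> (real \<Rightarrow> real^'d^('n::{finite,linorder})) \<Rightarrow> bool" where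
  "total_collision_solution m t0 T q \<longleftrightarrow>
     t0 < T \<and> newton_solution m {t0..<T} q \<and> (q \<longlongrightarrow> 0) (at_left T)"

definition unit_configs :: "('n \<Rightarrow> real) \<Rightarrow> (real^'d^'n) set" where
  "unit_configs m = {s \<in> centered m. mass_norm m s = 1}"

text \<open>
  A zero derivative of \<open>U\<close> within the collision-free part of the unit sphere says that the
  differential of the restriction vanishes: \<open>U(s') - U(s) = o(|s' - s|)\<close> for \<open>s'\<close> in that set.
\<close>

definition normalized_CC :: "('n \<Rightarrow> real) \<Rightarrow> real^'d^('n::{finite,linorder}) \<Rightarrow> bool" where
  "normalized_CC m s \<longleftrightarrow>
     s \<in> unit_configs m \<and> collision_free s \<and>
     (newton_U m has_derivative (\<lambda>h. 0)) (at s within {s' \<in> unit_configs m. collision_free s'})"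

definition rotation_orbit :: "real^'d^'n \<Rightarrow> (real^'d^'n) set" where
  "rotation_orbit s = {(\<chi> a. g *v s $ a) |g. rotation_matrix g}"

definition mass_infdist :: "('n \<Rightarrow> real) \<Rightarrow> real^'d^'n \<Rightarrow> (real^'d^'n) set \<Rightarrow> real" where
  "mass_infdist m x A = (INF y\<in>A. mass_norm m (x - y))"

definition has_limiting_shape ::
    "('n \<Rightarrow> real) \<Rightarrow> real \<Rightarrow> (real \<Rightarrow> real^'d^('n::{finite,linorder})) \<Rightarrow>
     real^'d^('n::{finite,linorder}) \<Rightarrow> bool" where
  "has_limiting_shape m T q s0 \<longleftrightarrow>
     normalized_CC m s0 \<and>
     ((\<lambda>t. mass_infdist m (q t /\<^sub>R mass_norm m (q t)) (rotation_orbit s0)) \<longlongrightarrow> 0) (at_left T)"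

definition collinear_config :: "real^'d^'n \<Rightarrow> bool" where
  "collinear_config q \<longleftrightarrow> dim (span (range (\<lambda>a. q $ a))) = 1"

end

(* Every coordinate z = (q_a . e)_a of the solution solves the same linear equation
   z'' = A(t) z, where A(t) depends only on the mutual distances. These are rotation invariant, so
   after rescaling by r = |q| the coefficients converge to those of the collinear central
   configuration s0 = c omega, without any control on the rotation of the shape. Sundman's
   asymptotics of r make the rescaled equation asymptotically autonomous, and Conley's theorem says
   that c spans the top eigenspace of the limiting operator on centered vectors. Hence the constant
   mode c is the only non-growing one, and the coordinates z / r, which are all bounded, depend on a
   single parameter: z is determined by one linear functional of the direction e. Its kernel is a
   hyperplane of directions in which the solution vanishes. *)

theory Submission
  imports Defs
begin


section \<open>Differential inequalities\<close>

text \<open>The shape converges without any rate, so the rescaled equation is only an o(1)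
  perturbation of its limit, and asymptotics for integrable errors do not apply. The limit has a
  neutral direction, so errors proportional to the full state could feed the growing modes from the
  neutral one. What survives is a cone argument: a quadratic form, positive where the neutral
  coordinate vanishes, whose rate dominates a multiple of it under every sufficiently small relative
  error. Rescaled time, \<open>dt = R d\<tau>\<close> with \<open>R = O(T - t)\<close>, runs to
  infinity, so a positive value would become unbounded, against the a priori bounds on the
  coordinates. Hence one linear condition at one time \<open>t1\<close> forces a coordinate to
  vanish. The admissible error depends on the limit system alone, and \<open>t1\<close> on limits
  not involving \<open>e\<close>; because of this uniformity a single linear functional of
  \<open>e\<close> decides for all directions at a common time.\<close>

lemma nondecreasing_within:
  fixes f :: "real \<Rightarrow> real"
  assumes "a \<le> b"
    and "\<And>x. x \<in> {a..b} \<Longrightarrow> (f has_real_derivative f' x) (at x within {a..b})"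
    and "\<And>x. x \<in> {a..b} \<Longrightarrow> 0 \<le> f' x"
  shows "f a \<le> f b"
proof (rule DERIV_nonneg_imp_increasing_open[OF assms(1)])
  show "\<exists>y. (f has_real_derivative y) (at x) \<and> 0 \<le> y" if "a < x" "x < b" for x
    using assms(2)[of x] assms(3)[of x] that by (auto simp: at_within_Icc_at)
  show "continuous_on {a..b} f"
    using DERIV_continuous[OF assms(2)] by (simp add: continuous_on_eq_continuous_within)
qed

text \<open>An integrating factor makes \<open>f * exp (- G)\<close> nondecreasing. Neither
  \<open>f\<close> nor \<open>g\<close> has a prescribed sign; the lemma serves as sign
  preservation, carrying positivity or nonnegativity of \<open>f\<close> from \<open>a\<close> to
  \<open>b\<close>.\<close>

lemma gronwall_lower:
  fixes f g :: "real \<Rightarrow> real"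
  assumes ab: "a \<le> b"
    and f: "\<And>x. x \<in> {a..b} \<Longrightarrow> (f has_real_derivative f' x) (at x within {a..b})"
    and g: "continuous_on {a..b} g"
    and ineq: "\<And>x. x \<in> {a..b} \<Longrightarrow> g x * f x \<le> f' x"
  shows "\<exists>E>0. E * f a \<le> f b"
proof -
  define G where "G x = integral {a..x} g" for x
  have G: "(G has_real_derivative g x) (at x within {a..b})" if "x \<in> {a..b}" for x
    unfolding G_def by (rule integral_has_real_derivative[OF g that])
  have "f a * exp (- G a) \<le> f b * exp (- G b)"
  proof (rule nondecreasing_within[OF ab])
    show "((\<lambda>x. f x * exp (- G x)) has_real_derivative (f' x - g x * f x) * exp (- G x))
        (at x within {a..b})" if "x \<in> {a..b}" for x
      by (rule derivative_eq_intros f[OF that] G[OF that] refl)+ (simp add: algebra_simps)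
  qed (use ineq in auto)
  moreover have "G a = 0" by (simp add: G_def)
  ultimately have "f a * exp (G b) \<le> f b * exp (- G b) * exp (G b)"
    by (intro mult_right_mono) auto
  also have "\<dots> = f b" by (simp add: mult.assoc flip: exp_add)
  finally show ?thesis by (intro exI[of _ "exp (G b)"]) (simp add: mult.commute)
qed

text \<open>\<open>K / (T - t)\<close> has infinite integral up to \<open>T\<close>. This is how the
  infinite length of rescaled time enters, without ever changing the time variable.\<close>

lemma log_growth_unbounded:
  fixes f :: "real \<Rightarrow> real"
  assumes "t1 < T" "0 < K"
    and f: "\<And>t. t \<in> {t1..<T} \<Longrightarrow> (f has_real_derivative f' t) (at t within {t1..<T})"
    and ge: "\<And>t. t \<in> {t1..<T} \<Longrightarrow> K / (T - t) \<le> f' t"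
    and bdd: "\<And>t. t \<in> {t1..<T} \<Longrightarrow> f t \<le> M"
  shows False
proof -
  define c where "c = f t1 + K * ln (T - t1)"
  \<comment> \<open>At distance \<open>d\<close> from \<open>T\<close> the lower bound
    \<open>c - K * ln d\<close> is at least \<open>M + K\<close>.\<close>
  define d where "d = min (T - t1) (exp ((c - M) / K - 1))"
  have d: "0 < d" "d \<le> T - t1" using \<open>t1 < T\<close> by (auto simp: d_def)
  have "c \<le> f (T - d) + K * ln (T - (T - d))"
    unfolding c_def
  proof (rule nondecreasing_within[where f = "\<lambda>t. f t + K * ln (T - t)"])
    show "t1 \<le> T - d" using d by simp
    fix x assume x: "x \<in> {t1..T - d}"
    then have "(f has_real_derivative f' x) (at x within {t1..T - d})"
      using d by (intro DERIV_subset[OF f]) auto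
    then show "((\<lambda>t. f t + K * ln (T - t)) has_real_derivative f' x - K / (T - x))
        (at x within {t1..T - d})"
      using x d by (auto intro!: derivative_eq_intros simp: field_simps)
    show "0 \<le> f' x - K / (T - x)" using ge[of x] x d by simp
  qed
  moreover have "K * ln d \<le> K * ((c - M) / K - 1)"
  proof (rule mult_left_mono)
    have "ln d \<le> ln (exp ((c - M) / K - 1))" using d by (subst ln_le_cancel_iff) (auto simp: d_def)
    then show "ln d \<le> (c - M) / K - 1" by simp
  qed (use \<open>0 < K\<close> in simp)
  moreover have "K * ((c - M) / K - 1) = c - M - K" using \<open>0 < K\<close> by (simp add: field_simps)
  moreover have "f (T - d) \<le> M" using bdd[of "T - d"] d by simp
  ultimately show False using \<open>0 < K\<close> by simp
qed

lemma has_real_derivative_inner: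
  fixes f g :: "real \<Rightarrow> 'a::real_inner"
  assumes "(f has_vector_derivative f') (at t within X)" "(g has_vector_derivative g') (at t within X)"
  shows "((\<lambda>t. f t \<bullet> g t) has_real_derivative f t \<bullet> g' + f' \<bullet> g t) (at t within X)"
  using bounded_bilinear.has_vector_derivative[OF bounded_bilinear_inner assms]
  by (simp add: has_real_derivative_iff_has_vector_derivative)

section \<open>A Lyapunov form with one neutral direction\<close>

text \<open>
  The limit system is \<open>S' = u\<close>, \<open>u' = (\<nu>/2) u - C S\<close> with \<open>C c = 0\<close> and \<open>C > 0\<close> orthogonally to \<open>c\<close>. Its
  only solutions bounded in forward time are the constants \<open>S \<in> \<real> c\<close>, \<open>u = 0\<close>, and \<open>S \<bullet> c - (2/\<nu>) (u \<bullet> c)\<close> is a first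
  integral. Subtracting its square from the energy (with a small cross term that makes the energy
  strictly increasing off the constants) gives a form whose rate dominates a multiple of the form.
\<close>

definition lyapunov ::
    "('a::real_inner \<Rightarrow> 'a) \<Rightarrow> 'a \<Rightarrow> real \<Rightarrow> real \<Rightarrow> 'a \<Rightarrow> 'a \<Rightarrow> real" where
  "lyapunov C c \<nu> \<epsilon> S u =
     (u \<bullet> u) / 2 + (C S \<bullet> S) / 2 - \<epsilon> * (u \<bullet> (S - (S \<bullet> c) *\<^sub>R c)) - (S \<bullet> c - 2 / \<nu> * (u \<bullet> c))\<^sup>2"

text \<open>The derivative of the form at a state with velocity \<open>s'\<close>,
  \<open>u'\<close>. It is linear in the velocity, so a change of time only multiplies it and errors
  in the equations split off additively.\<close>

definition lyapunov_rate ::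
    "('a::real_inner \<Rightarrow> 'a) \<Rightarrow> 'a \<Rightarrow> real \<Rightarrow> real \<Rightarrow> 'a \<Rightarrow> 'a \<Rightarrow> 'a \<Rightarrow> 'a \<Rightarrow> real" where
  "lyapunov_rate C c \<nu> \<epsilon> S u s' u' =
     u \<bullet> u' + C S \<bullet> s' - \<epsilon> * (u' \<bullet> (S - (S \<bullet> c) *\<^sub>R c) + u \<bullet> (s' - (s' \<bullet> c) *\<^sub>R c))
     - 2 * (S \<bullet> c - 2 / \<nu> * (u \<bullet> c)) * (s' \<bullet> c - 2 / \<nu> * (u' \<bullet> c))"

lemma lyapunov_has_derivative:
  assumes C: "bounded_linear C" and sym: "\<And>x y. C x \<bullet> y = x \<bullet> C y"
    and S: "(S has_vector_derivative s') (at t within X)"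
    and u: "(u has_vector_derivative u') (at t within X)"
  shows "((\<lambda>t. lyapunov C c \<nu> \<epsilon> (S t) (u t)) has_real_derivative
           lyapunov_rate C c \<nu> \<epsilon> (S t) (u t) s' u') (at t within X)"
proof -
  note inner = has_real_derivative_inner
  have CS: "((\<lambda>t. C (S t)) has_vector_derivative C s') (at t within X)"
    by (rule bounded_linear.has_vector_derivative[OF C S])
  have c: "((\<lambda>t. c) has_vector_derivative 0) (at t within X)" by simp
  note Sc = inner[OF S c] and uc = inner[OF u c]
  have P: "((\<lambda>t. S t - (S t \<bullet> c) *\<^sub>R c) has_vector_derivative s' - (s' \<bullet> c) *\<^sub>R c) (at t within X)"
    using has_vector_derivative_diff[OF S has_vector_derivative_scaleR[OF Sc c]] by simp
  show ?thesis
    unfolding lyapunov_def lyapunov_rate_def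
    by (rule DERIV_cong[OF DERIV_diff[OF DERIV_diff[OF DERIV_add[OF
            DERIV_cdivide[OF inner[OF u u], where c = 2] DERIV_cdivide[OF inner[OF CS S], where c = 2]]
            DERIV_cmult[OF inner[OF u P]]]
            DERIV_power[OF DERIV_diff[OF Sc DERIV_cmult[OF uc]], where n = 2]]])
      (simp add: sym inner_commute[of u'] inner_commute[of s'] algebra_simps)
qed


text \<open>The energy alone has a rate controlling only \<open>u\<close>; the cross term makes it
  control the part of \<open>S\<close> orthogonal to \<open>c\<close> as well. Along
  \<open>c\<close> nothing grows, and the slack there comes from the subtracted square: it adds
  nothing to the unperturbed rate but a negative amount to the form.\<close>

lemma lyapunov_form_exists:
  fixes c :: "'a::real_inner" and C :: "'a \<Rightarrow> 'a"
  assumes C: "bounded_linear C" and sym: "\<And>x y. C x \<bullet> y = x \<bullet> C y"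
    and Cc: "C c = 0" and c: "norm c = 1"
    and E: "subspace E" "c \<in> E"
    and \<delta>: "\<delta> > 0" "\<And>y. y \<in> E \<Longrightarrow> y \<bullet> c = 0 \<Longrightarrow> \<delta> * (norm y)\<^sup>2 \<le> C y \<bullet> y"
    and \<nu>: "\<nu> > 0"
  obtains \<epsilon> \<theta> \<eta> where "\<epsilon> > 0" "\<theta> > 0" "\<eta> > 0"
    "\<And>S u. S \<in> E \<Longrightarrow> u \<in> E \<Longrightarrow> S \<bullet> c = 2 / \<nu> * (u \<bullet> c) \<Longrightarrow> lyapunov C c \<nu> \<epsilon> S u \<le> 0 \<Longrightarrow> S = 0 \<and> u = 0"
    "\<And>S u s' u'. S \<in> E \<Longrightarrow> u \<in> E \<Longrightarrow>
        norm (s' - u) \<le> \<eta> * (norm S + norm u) \<Longrightarrow>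
        norm (u' - ((\<nu> / 2) *\<^sub>R u - C S)) \<le> \<eta> * (norm S + norm u) \<Longrightarrow>
        \<theta> * lyapunov C c \<nu> \<epsilon> S u \<le> lyapunov_rate C c \<nu> \<epsilon> S u s' u'"
proof -
  interpret C: bounded_linear C by fact
  obtain K where K: "K > 0" "\<And>z. norm (C z) \<le> norm z * K" using C.pos_bounded by blast
  have cc: "c \<bullet> c = 1" using c by (simp add: norm_eq_1)
  define P where "P z = z - (z \<bullet> c) *\<^sub>R c" for z
  have Pc: "P z \<bullet> c = 0" for z by (simp add: P_def inner_diff_left cc)
  have Padd: "P (x + z) = P x + P z" for x z by (simp add: P_def inner_add_left algebra_simps)
  have PE: "P z \<in> E" if "z \<in> E" for z
    unfolding P_def using E that by (intro subspace_diff subspace_scale)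
  have CP: "C (P z) = C z" for z by (simp add: P_def C.diff C.scaleR Cc)
  have Corth: "C z \<bullet> c = 0" for z by (simp add: sym Cc)
  have CPP: "C z \<bullet> P z = C (P z) \<bullet> P z" "C z \<bullet> z = C (P z) \<bullet> P z" for z
    by (simp_all add: CP) (simp add: P_def inner_diff_right Corth)
  have pyth: "(norm z)\<^sup>2 = (norm (P z))\<^sup>2 + (z \<bullet> c)\<^sup>2" for z
    unfolding power2_norm_eq_inner P_def
    by (simp add: algebra_simps inner_commute cc power2_eq_square)
  have Ple: "norm (P z) \<le> norm z" for z
    by (rule power2_le_imp_le) (use pyth[of z] in auto)
  have cle: "\<bar>z \<bullet> c\<bar> \<le> norm z" for z
    using Cauchy_Schwarz_ineq2[of z c] c by simp

  \<comment> \<open>The first bound keeps the form definite where the first integral vanishes; the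
    second leaves half of the rate \<open>\<nu> / 2 * U\<^sup>2\<close> after the cross term is paid
    for.\<close>
  define \<epsilon> where "\<epsilon> = min (sqrt \<delta> / 2) ((\<nu> / 4) / (1 + \<nu>\<^sup>2 / (8 * \<delta>)))"
  have p: "1 + \<nu>\<^sup>2 / (8 * \<delta>) > 0" using \<delta>(1) by (simp add: add_pos_nonneg)
  have \<epsilon>0: "\<epsilon> > 0" using \<delta>(1) \<nu> p by (simp add: \<epsilon>_def)
  have "\<epsilon> \<le> sqrt \<delta> / 2" unfolding \<epsilon>_def by (rule min.cobounded1)
  then have "\<epsilon>\<^sup>2 \<le> (sqrt \<delta> / 2)\<^sup>2" using \<epsilon>0 by (intro power_mono) auto
  then have \<epsilon>1: "\<epsilon>\<^sup>2 \<le> \<delta> / 4" using \<delta>(1) by (simp add: power_divide)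
  have \<epsilon>2: "\<epsilon> * (1 + \<nu>\<^sup>2 / (8 * \<delta>)) \<le> \<nu> / 4"
    unfolding pos_le_divide_eq[OF p, symmetric] \<epsilon>_def by (rule min.cobounded2)
  \<comment> \<open>\<theta> times the form may use up half of the rate found in
    \<open>main\<close>. The other half, together with the slack from the square, bounds \<kappa>
    times the squared size of the state.\<close>
  define \<theta> where "\<theta> = min ((\<nu> / 8) / (1 / 2 + \<epsilon>)) ((\<epsilon> * \<delta> / 4) / (K / 2 + \<epsilon>))"
  have \<theta>0: "\<theta> > 0" using \<nu> \<epsilon>0 \<delta>(1) K by (auto simp: \<theta>_def intro!: divide_pos_pos)
  have p1: "1 / 2 + \<epsilon> > 0" and p2: "K / 2 + \<epsilon> > 0" using \<epsilon>0 K by simp_all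
  have \<theta>1: "\<theta> * (1 / 2 + \<epsilon>) \<le> \<nu> / 8"
    unfolding pos_le_divide_eq[OF p1, symmetric] \<theta>_def by (rule min.cobounded1)
  have \<theta>2: "\<theta> * (K / 2 + \<epsilon>) \<le> \<epsilon> * \<delta> / 4"
    unfolding pos_le_divide_eq[OF p2, symmetric] \<theta>_def by (rule min.cobounded2)
  define \<kappa> where "\<kappa> = min ((\<nu> / 8) / (16 / \<nu>\<^sup>2 + 2)) (min (\<epsilon> * \<delta> / 8) (\<theta> / 4))"
  have q: "16 / \<nu>\<^sup>2 + 2 > 0" by (simp add: add_nonneg_pos)
  have \<kappa>0: "\<kappa> > 0" using \<nu> \<epsilon>0 \<delta>(1) \<theta>0 q by (auto simp: \<kappa>_def)
  have \<kappa>1: "\<kappa> * (16 / \<nu>\<^sup>2 + 2) \<le> \<nu> / 8"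
    unfolding pos_le_divide_eq[OF q, symmetric] \<kappa>_def by (rule min.cobounded1)
  have "\<kappa> \<le> \<epsilon> * \<delta> / 8" "\<kappa> \<le> \<theta> / 4" unfolding \<kappa>_def by linarith+
  then have \<kappa>2: "2 * \<kappa> \<le> \<epsilon> * \<delta> / 4" and \<kappa>3: "4 * \<kappa> \<le> \<theta>" by simp_all
  \<comment> \<open>\<open>L\<close> collects the coefficients of the error terms in
    \<open>err\<close>, with one \<epsilon> to spare.\<close>
  define L where "L = 1 + K + 3 * \<epsilon> + 2 * (1 + 2 / \<nu>)\<^sup>2"
  have L: "L > 0" using K \<epsilon>0 by (auto simp: L_def intro!: add_pos_nonneg)
  define \<eta> where "\<eta> = \<kappa> / L"
  have \<eta>0: "\<eta> > 0" using L \<kappa>0 by (simp add: \<eta>_def)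

  show thesis
  proof (rule that[OF \<epsilon>0 \<theta>0 \<eta>0])
    fix S u assume Su: "S \<in> E" "u \<in> E" "S \<bullet> c = 2 / \<nu> * (u \<bullet> c)" "lyapunov C c \<nu> \<epsilon> S u \<le> 0"
    have "\<epsilon> * (u \<bullet> P S) \<le> \<epsilon> * (norm u * norm (P S))"
      using \<epsilon>0 norm_cauchy_schwarz[of u "P S"] by (intro mult_left_mono) auto
    also have "\<dots> \<le> (norm u)\<^sup>2 / 4 + \<epsilon>\<^sup>2 * (norm (P S))\<^sup>2"
      using sum_squares_ge_zero[of "norm u / 2 - \<epsilon> * norm (P S)" 0]
      by (simp add: power2_eq_square algebra_simps)
    also have "\<dots> \<le> (norm u)\<^sup>2 / 4 + \<delta> / 4 * (norm (P S))\<^sup>2"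
      using mult_right_mono[OF \<epsilon>1, of "(norm (P S))\<^sup>2"] by simp
    finally have "(norm u)\<^sup>2 / 4 + \<delta> / 4 * (norm (P S))\<^sup>2 \<le> lyapunov C c \<nu> \<epsilon> S u"
      using \<delta>(2)[OF PE[OF Su(1)] Pc]
      unfolding lyapunov_def CPP(2)[of S] P_def[symmetric] unfolding Su(3) by (simp add: power2_norm_eq_inner)
    with Su(4) have *: "(norm u)\<^sup>2 / 4 + \<delta> / 4 * (norm (P S))\<^sup>2 \<le> 0" by simp
    moreover have "0 \<le> \<delta> / 4 * (norm (P S))\<^sup>2" using \<delta>(1) by simp
    ultimately have "(norm u)\<^sup>2 \<le> 0" "\<delta> / 4 * (norm (P S))\<^sup>2 \<le> 0"
      using zero_le_power2[of "norm u"] by linarith+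
    then have u: "u = 0" and "P S = 0" using \<delta>(1) by (auto simp: mult_le_0_iff)
    then show "S = 0 \<and> u = 0" using Su(3) by (simp add: P_def)
  next
    fix S u s' u' assume Su: "S \<in> E" "u \<in> E"
      and e1: "norm (s' - u) \<le> \<eta> * (norm S + norm u)"
      and e2: "norm (u' - ((\<nu> / 2) *\<^sub>R u - C S)) \<le> \<eta> * (norm S + norm u)"
    define n Y U a where "n = norm S + norm u" "Y = norm (P S)" "U = norm u"
      "a = S \<bullet> c - 2 / \<nu> * (u \<bullet> c)"
    note defs = this
    define e f where "e = s' - u" "f = u' - ((\<nu> / 2) *\<^sub>R u - C S)"
    note ef = this
    have s': "s' = u + e" and u': "u' = ((\<nu> / 2) *\<^sub>R u - C S) + f" by (simp_all add: ef)
    have e: "norm e \<le> \<eta> * n" and f: "norm f \<le> \<eta> * n" using e1 e2 by (simp_all add: ef defs)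
    have n0: "0 \<le> n" "norm S \<le> n" "U \<le> n" "0 \<le> U" "0 \<le> Y" "Y \<le> norm S"
      by (simp_all add: defs Ple)
    have coer: "\<delta> * Y\<^sup>2 \<le> C (P S) \<bullet> P S"
      using \<delta>(2)[OF PE[OF Su(1)] Pc] by (simp add: defs)
    have uP: "\<bar>u \<bullet> P S\<bar> \<le> U * Y" using Cauchy_Schwarz_ineq2 by (simp add: defs)
    have uu: "u \<bullet> u = U\<^sup>2" by (simp add: defs power2_norm_eq_inner)
    \<comment> \<open>The first bracket is the rate of the limit system, where the first integral
      contributes nothing; the second is linear in the errors \<open>e\<close> and
      \<open>f\<close>.\<close>
    have split: "lyapunov_rate C c \<nu> \<epsilon> S u s' u'
        = (\<nu> / 2 * U\<^sup>2 - \<epsilon> * (\<nu> / 2 * (u \<bullet> P S) - C (P S) \<bullet> P S + (U\<^sup>2 - (u \<bullet> c)\<^sup>2)))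
          + (u \<bullet> f + C S \<bullet> e - \<epsilon> * (f \<bullet> P S + u \<bullet> P e) - 2 * a * (e \<bullet> c - 2 / \<nu> * (f \<bullet> c)))"
      unfolding lyapunov_rate_def s' u' P_def[symmetric] defs(4)[symmetric]
      using \<nu> by (simp add: Padd P_def[of u] inner_add_left inner_add_right inner_diff_left
          inner_diff_right Corth CPP(1) uu inner_commute[of u "C S"]
          power2_eq_square algebra_simps)
    have main: "\<nu> / 4 * U\<^sup>2 + \<epsilon> * \<delta> / 2 * Y\<^sup>2
        \<le> \<nu> / 2 * U\<^sup>2 - \<epsilon> * (\<nu> / 2 * (u \<bullet> P S) - C (P S) \<bullet> P S + (U\<^sup>2 - (u \<bullet> c)\<^sup>2))"
    proof -
      have "\<nu> / 2 * (u \<bullet> P S) \<le> \<nu> / 2 * (U * Y)" using uP \<nu> by (intro mult_left_mono) auto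
      also have "\<dots> \<le> \<delta> / 2 * Y\<^sup>2 + \<nu>\<^sup>2 / (8 * \<delta>) * U\<^sup>2"
        using \<delta>(1) zero_le_power2[of "2 * \<delta> * Y - \<nu> * U"]
        by (simp add: field_simps power2_eq_square)
      finally have "\<nu> / 2 * (u \<bullet> P S) - C (P S) \<bullet> P S + (U\<^sup>2 - (u \<bullet> c)\<^sup>2)
          \<le> (1 + \<nu>\<^sup>2 / (8 * \<delta>)) * U\<^sup>2 - \<delta> / 2 * Y\<^sup>2"
        using coer zero_le_power2[of "u \<bullet> c"] unfolding distrib_right mult_1 by linarith
      then have "\<epsilon> * (\<nu> / 2 * (u \<bullet> P S) - C (P S) \<bullet> P S + (U\<^sup>2 - (u \<bullet> c)\<^sup>2))
          \<le> \<epsilon> * ((1 + \<nu>\<^sup>2 / (8 * \<delta>)) * U\<^sup>2 - \<delta> / 2 * Y\<^sup>2)"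
        using \<epsilon>0 by (intro mult_left_mono) auto
      also have "\<dots> \<le> \<nu> / 4 * U\<^sup>2 - \<epsilon> * \<delta> / 2 * Y\<^sup>2"
        using mult_right_mono[OF \<epsilon>2, of "U\<^sup>2"] by (simp add: algebra_simps)
      finally show ?thesis by (simp add: algebra_simps)
    qed
    have upper: "\<theta> * lyapunov C c \<nu> \<epsilon> S u \<le> \<nu> / 8 * U\<^sup>2 + \<epsilon> * \<delta> / 4 * Y\<^sup>2 - \<theta> * a\<^sup>2"
    proof -
      have "C (P S) \<bullet> P S \<le> K * Y\<^sup>2"
        using norm_cauchy_schwarz[of "C (P S)" "P S"] mult_right_mono[OF K(2)[of "P S"], of Y] n0
        by (simp add: defs power2_eq_square algebra_simps)
      moreover have "- (\<epsilon> * (u \<bullet> P S)) \<le> \<epsilon> * (U\<^sup>2 + Y\<^sup>2)"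
      proof -
        have "- (u \<bullet> P S) \<le> U\<^sup>2 + Y\<^sup>2"
          using uP zero_le_power2[of "U - Y"] zero_le_power2[of U] zero_le_power2[of Y]
          by (simp add: power2_diff)
        from mult_left_mono[OF this, of \<epsilon>] \<epsilon>0 show ?thesis by simp
      qed
      ultimately have "lyapunov C c \<nu> \<epsilon> S u \<le> (1 / 2 + \<epsilon>) * U\<^sup>2 + (K / 2 + \<epsilon>) * Y\<^sup>2 - a\<^sup>2"
        unfolding lyapunov_def CPP(2)[of S] P_def[symmetric] defs(4)[symmetric]
        by (simp add: power2_norm_eq_inner[of u, symmetric] defs(3)[symmetric] algebra_simps)
      then have "\<theta> * lyapunov C c \<nu> \<epsilon> S u \<le> \<theta> * ((1 / 2 + \<epsilon>) * U\<^sup>2 + (K / 2 + \<epsilon>) * Y\<^sup>2 - a\<^sup>2)"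
        using \<theta>0 by (intro mult_left_mono) auto
      also have "\<dots> \<le> \<nu> / 8 * U\<^sup>2 + \<epsilon> * \<delta> / 4 * Y\<^sup>2 - \<theta> * a\<^sup>2"
        using mult_right_mono[OF \<theta>1, of "U\<^sup>2"] mult_right_mono[OF \<theta>2, of "Y\<^sup>2"]
        by (simp add: algebra_simps)
      finally show ?thesis .
    qed
    \<comment> \<open>The neutral part \<open>S \<bullet> c\<close> of the state is recovered from
      the first integral \<open>a\<close> and from \<open>u\<close>.\<close>
    have size: "\<kappa> * n\<^sup>2 \<le> \<nu> / 8 * U\<^sup>2 + \<epsilon> * \<delta> / 4 * Y\<^sup>2 + \<theta> * a\<^sup>2"
    proof -
      have "n\<^sup>2 \<le> 2 * (norm S)\<^sup>2 + 2 * U\<^sup>2"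
        using zero_le_power2[of "norm S - norm u"] by (simp add: defs power2_eq_square algebra_simps)
      moreover have "(S \<bullet> c)\<^sup>2 \<le> 2 * a\<^sup>2 + 8 / \<nu>\<^sup>2 * U\<^sup>2"
      proof -
        have "(S \<bullet> c)\<^sup>2 \<le> 2 * a\<^sup>2 + 2 * (2 / \<nu> * (u \<bullet> c))\<^sup>2"
          using zero_le_power2[of "a - 2 / \<nu> * (u \<bullet> c)"]
          by (simp add: defs(4) power2_eq_square algebra_simps)
        also have "2 * (2 / \<nu> * (u \<bullet> c))\<^sup>2 = 8 / \<nu>\<^sup>2 * (u \<bullet> c)\<^sup>2"
          by (simp add: power_mult_distrib power_divide)
        also have "(u \<bullet> c)\<^sup>2 \<le> U\<^sup>2" using cle[of u] by (simp add: defs abs_le_square_iff[symmetric])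
        then have "8 / \<nu>\<^sup>2 * (u \<bullet> c)\<^sup>2 \<le> 8 / \<nu>\<^sup>2 * U\<^sup>2" by (intro mult_left_mono) auto
        finally show ?thesis by simp
      qed
      ultimately have "n\<^sup>2 \<le> 2 * Y\<^sup>2 + 4 * a\<^sup>2 + (16 / \<nu>\<^sup>2 + 2) * U\<^sup>2"
        using pyth[of S] unfolding defs(2)[symmetric] by (simp add: distrib_right)
      then have "\<kappa> * n\<^sup>2 \<le> \<kappa> * (2 * Y\<^sup>2 + 4 * a\<^sup>2 + (16 / \<nu>\<^sup>2 + 2) * U\<^sup>2)"
        using \<kappa>0 by (intro mult_left_mono) auto
      also have "\<dots> = (2 * \<kappa>) * Y\<^sup>2 + (4 * \<kappa>) * a\<^sup>2 + (\<kappa> * (16 / \<nu>\<^sup>2 + 2)) * U\<^sup>2"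
        by (simp add: algebra_simps)
      also have "\<dots> \<le> \<epsilon> * \<delta> / 4 * Y\<^sup>2 + \<theta> * a\<^sup>2 + \<nu> / 8 * U\<^sup>2"
        using \<kappa>1 \<kappa>2 \<kappa>3 by (intro add_mono mult_right_mono) auto
      finally show ?thesis by simp
    qed
    have err: "- (\<eta> * L * n\<^sup>2)
        \<le> u \<bullet> f + C S \<bullet> e - \<epsilon> * (f \<bullet> P S + u \<bullet> P e) - 2 * a * (e \<bullet> c - 2 / \<nu> * (f \<bullet> c))"
    proof -
      have \<eta>n: "0 \<le> \<eta> * n" using \<eta>0 n0 by simp
      have bb: "\<bar>x \<bullet> y\<bar> \<le> A * B" if "norm x \<le> A" "norm y \<le> B" for x y :: 'a and A B
        using that norm_ge_zero[of x] norm_ge_zero[of y]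
        by (intro order_trans[OF Cauchy_Schwarz_ineq2] mult_mono) linarith+
      have u: "norm u \<le> n" using n0(3) by (simp add: defs(3))
      have PS: "norm (P S) \<le> n" using n0 unfolding defs(2) by linarith
      have Pe: "norm (P e) \<le> \<eta> * n" by (rule order_trans[OF Ple e])
      have CS: "norm (C S) \<le> n * K"
        using K(2)[of S] mult_right_mono[OF n0(2), of K] K(1) by linarith
      note b1 = bb[OF u f] and b2 = bb[OF CS e] and b3 = bb[OF f PS] and b4 = bb[OF u Pe]
      have "\<bar>2 / \<nu> * (z \<bullet> c)\<bar> \<le> 2 / \<nu> * norm z" for z
        using mult_left_mono[OF cle[of z], of "2 / \<nu>"] \<nu> by (simp add: abs_mult)
      note b = this
      have ba: "\<bar>a\<bar> \<le> (1 + 2 / \<nu>) * n"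
      proof -
        have "\<bar>a\<bar> \<le> norm S + 2 / \<nu> * norm u" using cle[of S] b[of u] unfolding defs(4) by linarith
        also have "\<dots> \<le> n + 2 / \<nu> * n"
          using n0 \<nu> by (intro add_mono mult_left_mono) (auto simp: defs)
        finally show ?thesis by (simp add: algebra_simps)
      qed
      have bg: "\<bar>e \<bullet> c - 2 / \<nu> * (f \<bullet> c)\<bar> \<le> (1 + 2 / \<nu>) * (\<eta> * n)"
      proof -
        have "\<bar>e \<bullet> c - 2 / \<nu> * (f \<bullet> c)\<bar> \<le> norm e + 2 / \<nu> * norm f"
          using cle[of e] b[of f] by linarith
        also have "\<dots> \<le> \<eta> * n + 2 / \<nu> * (\<eta> * n)"
          using e f \<nu> by (intro add_mono mult_left_mono) auto
        finally show ?thesis by (simp add: algebra_simps)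
      qed
      have b5: "\<bar>a * (e \<bullet> c - 2 / \<nu> * (f \<bullet> c))\<bar> \<le> ((1 + 2 / \<nu>) * n) * ((1 + 2 / \<nu>) * (\<eta> * n))"
        unfolding abs_mult using ba bg \<nu> n0 by (intro mult_mono) auto
      have "\<bar>\<epsilon> * (f \<bullet> P S + u \<bullet> P e)\<bar> \<le> \<epsilon> * (2 * (\<eta> * n\<^sup>2))"
        unfolding abs_mult using \<epsilon>0 b3 b4 by (auto intro!: mult_left_mono simp: power2_eq_square algebra_simps)
      moreover have "\<epsilon> * (\<eta> * n\<^sup>2) \<ge> 0" using \<epsilon>0 \<eta>0 by simp
      moreover have "\<eta> * L * n\<^sup>2 = n * (\<eta> * n) + n * K * (\<eta> * n) + \<epsilon> * (2 * (\<eta> * n\<^sup>2))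
         + \<epsilon> * (\<eta> * n\<^sup>2) + 2 * (((1 + 2 / \<nu>) * n) * ((1 + 2 / \<nu>) * (\<eta> * n)))"
      proof -
        have "\<eta> * (1 + K + 3 * \<epsilon> + 2 * \<beta>\<^sup>2) * n\<^sup>2 = n * (\<eta> * n) + n * K * (\<eta> * n) + \<epsilon> * (2 * (\<eta> * n\<^sup>2))
           + \<epsilon> * (\<eta> * n\<^sup>2) + 2 * ((\<beta> * n) * (\<beta> * (\<eta> * n)))" for \<beta>
          by (simp add: power2_eq_square algebra_simps)
        then show ?thesis unfolding L_def .
      qed
      ultimately show ?thesis using b1 b2 b5 by (simp add: mult.assoc abs_le_iff)
    qed
    have "\<eta> * L = \<kappa>" using L by (simp add: \<eta>_def)
    then show "\<theta> * lyapunov C c \<nu> \<epsilon> S u \<le> lyapunov_rate C c \<nu> \<epsilon> S u s' u'"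
      unfolding split using err main upper size by simp
  qed
qed


text \<open>A nonzero state with vanishing first integral makes the form positive, and its growth
  then contradicts the bound \<open>M\<close>. The threshold \<eta> is fixed before the functions,
  so it serves all coordinates of a solution at once. \<open>R\<close> is the rate of the time
  change.\<close>

lemma fast_mode_vanishing:
  fixes c :: "'a::real_inner" and C :: "'a \<Rightarrow> 'a"
  assumes C: "bounded_linear C" and sym: "\<And>x y. C x \<bullet> y = x \<bullet> C y"
    and Cc: "C c = 0" and c: "norm c = 1"
    and E: "subspace E" "c \<in> E"
    and \<delta>: "\<delta> > 0" "\<And>y. y \<in> E \<Longrightarrow> y \<bullet> c = 0 \<Longrightarrow> \<delta> * (norm y)\<^sup>2 \<le> C y \<bullet> y"
    and \<nu>: "\<nu> > 0"
  obtains \<eta> where "\<eta> > 0"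
    "\<And>t1 T S u S' u' R K M. \<lbrakk>t1 < (T::real);
        \<And>t. t \<in> {t1..<T} \<Longrightarrow> (S has_vector_derivative S' t) (at t within {t1..<T});
        \<And>t. t \<in> {t1..<T} \<Longrightarrow> (u has_vector_derivative u' t) (at t within {t1..<T});
        \<And>t. t \<in> {t1..<T} \<Longrightarrow> S t \<in> E; \<And>t. t \<in> {t1..<T} \<Longrightarrow> u t \<in> E;
        continuous_on {t1..<T} R; \<And>t. t \<in> {t1..<T} \<Longrightarrow> 0 < R t; 0 < K;
        \<And>t. t \<in> {t1..<T} \<Longrightarrow> R t \<le> K * (T - t);
        \<And>t. t \<in> {t1..<T} \<Longrightarrow> norm (R t *\<^sub>R S' t - u t) \<le> \<eta> * (norm (S t) + norm (u t));
        \<And>t. t \<in> {t1..<T} \<Longrightarrow>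
          norm (R t *\<^sub>R u' t - ((\<nu> / 2) *\<^sub>R u t - C (S t))) \<le> \<eta> * (norm (S t) + norm (u t));
        \<And>t. t \<in> {t1..<T} \<Longrightarrow> norm (S t) \<le> M; \<And>t. t \<in> {t1..<T} \<Longrightarrow> norm (u t) \<le> M;
        S t1 \<bullet> c = 2 / \<nu> * (u t1 \<bullet> c)\<rbrakk> \<Longrightarrow> S t1 = 0 \<and> u t1 = 0"
proof -
  obtain \<epsilon> \<theta> \<eta> where \<epsilon>: "\<epsilon> > 0" and \<theta>: "\<theta> > 0" and \<eta>: "\<eta> > 0"
    and definite: "\<And>S u. S \<in> E \<Longrightarrow> u \<in> E \<Longrightarrow> S \<bullet> c = 2 / \<nu> * (u \<bullet> c) \<Longrightarrow>
        lyapunov C c \<nu> \<epsilon> S u \<le> 0 \<Longrightarrow> S = 0 \<and> u = 0"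
    and growth: "\<And>S u s' u'. S \<in> E \<Longrightarrow> u \<in> E \<Longrightarrow>
        norm (s' - u) \<le> \<eta> * (norm S + norm u) \<Longrightarrow>
        norm (u' - ((\<nu> / 2) *\<^sub>R u - C S)) \<le> \<eta> * (norm S + norm u) \<Longrightarrow>
        \<theta> * lyapunov C c \<nu> \<epsilon> S u \<le> lyapunov_rate C c \<nu> \<epsilon> S u s' u'"
    using lyapunov_form_exists[OF C sym Cc c E \<delta> \<nu>] by metis
  obtain B where B: "B > 0" "\<And>z. norm (C z) \<le> norm z * B"
    using bounded_linear.pos_bounded[OF C] by blast
  show thesis
  proof (rule that[OF \<eta>], rule ccontr)
    fix t1 T :: real and S u S' u' :: "real \<Rightarrow> 'a" and R :: "real \<Rightarrow> real" and K M :: real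
    assume "t1 < T"
      and S: "\<And>t. t \<in> {t1..<T} \<Longrightarrow> (S has_vector_derivative S' t) (at t within {t1..<T})"
      and u: "\<And>t. t \<in> {t1..<T} \<Longrightarrow> (u has_vector_derivative u' t) (at t within {t1..<T})"
      and SE: "\<And>t. t \<in> {t1..<T} \<Longrightarrow> S t \<in> E" and uE: "\<And>t. t \<in> {t1..<T} \<Longrightarrow> u t \<in> E"
      and R: "continuous_on {t1..<T} R" "\<And>t. t \<in> {t1..<T} \<Longrightarrow> 0 < R t"
      and K: "0 < K" "\<And>t. t \<in> {t1..<T} \<Longrightarrow> R t \<le> K * (T - t)"
      and eS: "\<And>t. t \<in> {t1..<T} \<Longrightarrow> norm (R t *\<^sub>R S' t - u t) \<le> \<eta> * (norm (S t) + norm (u t))"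
      and eu: "\<And>t. t \<in> {t1..<T} \<Longrightarrow>
          norm (R t *\<^sub>R u' t - ((\<nu> / 2) *\<^sub>R u t - C (S t))) \<le> \<eta> * (norm (S t) + norm (u t))"
      and MS: "\<And>t. t \<in> {t1..<T} \<Longrightarrow> norm (S t) \<le> M"
      and Mu: "\<And>t. t \<in> {t1..<T} \<Longrightarrow> norm (u t) \<le> M"
      and init: "S t1 \<bullet> c = 2 / \<nu> * (u t1 \<bullet> c)" and nz: "\<not> (S t1 = 0 \<and> u t1 = 0)"
    define f where "f t = lyapunov C c \<nu> \<epsilon> (S t) (u t)" for t
    define f' where "f' t = lyapunov_rate C c \<nu> \<epsilon> (S t) (u t) (S' t) (u' t)" for t
    have t1: "t1 \<in> {t1..<T}" using \<open>t1 < T\<close> by simp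
    have f1: "f t1 > 0"
      using definite[OF SE[OF t1] uE[OF t1] init] nz by (force simp: f_def)
    have df: "(f has_real_derivative f' t) (at t within {t1..<T})" if "t \<in> {t1..<T}" for t
      unfolding f_def f'_def by (rule lyapunov_has_derivative[OF C sym S[OF that] u[OF that]])
    have rate: "\<theta> / R t * f t \<le> f' t" if t: "t \<in> {t1..<T}" for t
    proof -
      have "lyapunov_rate C c \<nu> \<epsilon> (S t) (u t) (R t *\<^sub>R S' t) (R t *\<^sub>R u' t) = R t * f' t"
        unfolding lyapunov_rate_def f'_def by (simp add: inner_diff_right algebra_simps)
      then have "\<theta> * f t \<le> R t * f' t"
        using growth[OF SE[OF t] uE[OF t] eS[OF t] eu[OF t]] by (simp add: f_def)
      then show ?thesis using R(2)[OF t] by (simp add: field_simps)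
    qed
    have df_sub: "(f has_real_derivative f' x) (at x within {t1..t})"
      if "x \<in> {t1..t}" "t \<in> {t1..<T}" for x t
      by (rule DERIV_subset[OF df]) (use that in auto)
    have pos: "f t > 0" if t: "t \<in> {t1..<T}" for t
    proof -
      have "continuous_on {t1..t} (\<lambda>x. \<theta> / R x)"
        using t R by (intro continuous_intros continuous_on_subset[OF R(1)]) (auto simp: less_imp_neq[THEN not_sym])
      then have "\<exists>E>0. E * f t1 \<le> f t"
        using t df_sub rate by (intro gronwall_lower[where f = f and g = "\<lambda>x. \<theta> / R x" and f' = f']) auto
      then show ?thesis using f1 by (metis less_le_trans mult_pos_pos)
    qed
    \<comment> \<open>Positivity turns the differential inequality into monotonicity, so
      \<open>f'\<close> is at least a constant over \<open>R\<close>, hence a constant over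
      \<open>T - t\<close>.\<close>
    have mono: "f t1 \<le> f t" if t: "t \<in> {t1..<T}" for t
    proof (rule nondecreasing_within[where f = f and f' = f'])
      fix x assume x: "x \<in> {t1..t}"
      then have "0 \<le> \<theta> / R x * f x"
        using \<theta> R(2)[of x] pos[of x] t by (intro mult_nonneg_nonneg divide_nonneg_pos) (auto simp: less_imp_le)
      with rate[of x] x t show "0 \<le> f' x" by auto
    qed (use t df_sub in auto)
    show False
    proof (rule log_growth_unbounded[OF \<open>t1 < T\<close> _ df])
      show "0 < \<theta> * f t1 / K" using \<theta> f1 K by simp
      show "\<theta> * f t1 / K / (T - t) \<le> f' t" if t: "t \<in> {t1..<T}" for t
      proof -
        have "\<theta> * f t1 / (K * (T - t)) \<le> \<theta> * f t1 / R t"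
          using \<theta> f1 K R(2)[OF t] K(2)[OF t] t by (intro divide_left_mono) auto
        also have "\<dots> \<le> \<theta> / R t * f t"
          using \<theta> R(2)[OF t] mono[OF t] by (simp add: divide_right_mono)
        finally show ?thesis using rate[OF t] by simp
      qed
      \<comment> \<open>The subtracted square only helps an upper bound; the other terms are bounded
        because \<open>S\<close> and \<open>u\<close> are.\<close>
      show "f t \<le> M * M / 2 + B * M * M / 2 + \<epsilon> * (M * (2 * M))" if t: "t \<in> {t1..<T}" for t
      proof -
        have M: "M \<ge> 0" using MS[OF t] norm_ge_zero[of "S t"] by linarith
        have bb: "\<bar>x \<bullet> y\<bar> \<le> A * B" if "norm x \<le> A" "norm y \<le> B" for x y :: 'a and A B
          using that norm_ge_zero[of x] norm_ge_zero[of y]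
          by (intro order_trans[OF Cauchy_Schwarz_ineq2] mult_mono) linarith+
        have "norm (C (S t)) \<le> B * M"
          using B(2)[of "S t"] mult_right_mono[OF MS[OF t], of B] B(1)
          unfolding mult.commute[of B] by linarith
        note b2 = bb[OF this MS[OF t]]
        have "norm (S t - (S t \<bullet> c) *\<^sub>R c) \<le> norm (S t) + \<bar>S t \<bullet> c\<bar> * norm c"
          by (metis norm_triangle_ineq4 norm_scaleR)
        also have "\<dots> \<le> 2 * M" using bb[OF MS[OF t], of c 1] MS[OF t] c by simp
        finally have b3: "\<bar>u t \<bullet> (S t - (S t \<bullet> c) *\<^sub>R c)\<bar> \<le> M * (2 * M)"
          by (rule bb[OF Mu[OF t]])
        have "- (\<epsilon> * (u t \<bullet> (S t - (S t \<bullet> c) *\<^sub>R c))) \<le> \<epsilon> * (M * (2 * M))"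
          using mult_left_mono[of "- (u t \<bullet> (S t - (S t \<bullet> c) *\<^sub>R c))" "M * (2 * M)" \<epsilon>] b3 \<epsilon> by simp
        moreover note zero_le_power2[of "S t \<bullet> c - 2 / \<nu> * (u t \<bullet> c)"] b2 bb[OF Mu[OF t] Mu[OF t]]
        ultimately show ?thesis unfolding f_def lyapunov_def by linarith
      qed
    qed
  qed
qed

section \<open>Conley's spectral gap for collinear central configurations\<close>

text \<open>At a maximizer of the quadratic form on the unit sphere of \<open>E\<close>, moving
  along the residual \<open>w\<close> would gain to first order in \<open>t\<close> and lose only to
  second order, so the residual vanishes.\<close>

lemma rayleigh_maximizer:
  fixes A :: "'a::euclidean_space \<Rightarrow> 'a"
  assumes A: "linear A" and sym: "\<And>x y. A x \<bullet> y = x \<bullet> A y"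
    and E: "subspace E" and inv: "\<And>x. x \<in> E \<Longrightarrow> A x \<in> E" and nt: "x0 \<in> E" "x0 \<noteq> 0"
  obtains y \<mu> where "y \<in> E" "norm y = 1" "A y = \<mu> *\<^sub>R y" "\<And>z. z \<in> E \<Longrightarrow> A z \<bullet> z \<le> \<mu> * (norm z)\<^sup>2"
proof -
  have "compact (E \<inter> sphere 0 1)"
    by (rule closed_Int_compact) (use closed_subspace[OF E] in auto)
  moreover have "x0 /\<^sub>R norm x0 \<in> E \<inter> sphere 0 1"
    using nt subspace_scale[OF E] by (auto simp: dist_norm)
  moreover have "continuous_on (E \<inter> sphere 0 1) (\<lambda>x. A x \<bullet> x)"
    using A by (intro continuous_intros linear_continuous_on linear_conv_bounded_linear[THEN iffD1])
  ultimately obtain y where "y \<in> E \<inter> sphere 0 1"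
    and "\<forall>z\<in>E \<inter> sphere 0 1. A z \<bullet> z \<le> A y \<bullet> y"
    using continuous_attains_sup[of "E \<inter> sphere 0 1" "\<lambda>x. A x \<bullet> x"] by blast
  then have y: "y \<in> E" "norm y = 1"
    and max: "\<And>z. z \<in> E \<Longrightarrow> norm z = 1 \<Longrightarrow> A z \<bullet> z \<le> A y \<bullet> y"
    by (auto simp: dist_norm)
  define \<mu> where "\<mu> = A y \<bullet> y"
  have bound: "A z \<bullet> z \<le> \<mu> * (norm z)\<^sup>2" if z: "z \<in> E" for z
  proof (cases "z = 0")
    case False
    have "A (z /\<^sub>R norm z) \<bullet> (z /\<^sub>R norm z) \<le> \<mu>"
      unfolding \<mu>_def using z False subspace_scale[OF E] by (intro max) auto
    then show ?thesis using False by (simp add: linear_scale[OF A] field_simps power2_eq_square)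
  qed (simp add: linear_0[OF A])
  define w where "w = A y - \<mu> *\<^sub>R y"
  have wE: "w \<in> E" unfolding w_def using y E by (intro subspace_diff inv subspace_scale)
  define B where "B = \<mu> * (norm w)\<^sup>2 - A w \<bullet> w"
  have B: "B \<ge> 0" using bound[OF wE] by (simp add: B_def)
  have quad: "2 * t * (norm w)\<^sup>2 \<le> t\<^sup>2 * B" for t
  proof -
    have "y + t *\<^sub>R w \<in> E" using y wE E by (intro subspace_add subspace_scale)
    from bound[OF this] have *: "A (y + t *\<^sub>R w) \<bullet> (y + t *\<^sub>R w) \<le> \<mu> * ((y + t *\<^sub>R w) \<bullet> (y + t *\<^sub>R w))"
      by (simp add: power2_norm_eq_inner)
    have yy: "y \<bullet> y = 1" using y by (simp add: norm_eq_1)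
    have ww: "(norm w)\<^sup>2 = A y \<bullet> w - \<mu> * (y \<bullet> w)"
      unfolding power2_norm_eq_inner by (subst (1) w_def) (simp add: inner_diff_left)
    have "A w \<bullet> y = A y \<bullet> w" by (metis sym inner_commute)
    then have "A (y + t *\<^sub>R w) \<bullet> (y + t *\<^sub>R w) = \<mu> + 2 * t * (A y \<bullet> w) + t\<^sup>2 * (A w \<bullet> w)"
      by (simp add: linear_add[OF A] linear_scale[OF A] inner_add_left inner_add_right \<mu>_def[symmetric]
          power2_eq_square algebra_simps)
    moreover have "(y + t *\<^sub>R w) \<bullet> (y + t *\<^sub>R w) = 1 + 2 * t * (y \<bullet> w) + t\<^sup>2 * (norm w)\<^sup>2"
      unfolding power2_norm_eq_inner
      by (simp add: inner_add_left inner_add_right yy inner_commute[of w y] power2_eq_square algebra_simps)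
    ultimately show ?thesis using * unfolding B_def by (subst ww) (simp add: algebra_simps)
  qed
  have "w = 0"
  proof (rule ccontr)
    assume "w \<noteq> 0"
    then have "0 < (norm w)\<^sup>2" by simp
    \<comment> \<open>The \<open>+ 1\<close> keeps the denominator positive when
      \<open>B = 0\<close>; any smaller positive \<open>t\<close> would also contradict
      \<open>quad\<close>.\<close>
    define t where "t = (norm w)\<^sup>2 / (B + 1)"
    have t: "t > 0" using \<open>w \<noteq> 0\<close> B by (simp add: t_def)
    have "t * (2 * (norm w)\<^sup>2) \<le> t * (t * B)" using quad[of t] by (simp add: power2_eq_square mult.assoc)
    then have "2 * (norm w)\<^sup>2 \<le> t * B" using t by simp
    also have "\<dots> \<le> t * (B + 1)" using t by simp
    also have "\<dots> = (norm w)\<^sup>2" using B by (simp add: t_def)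
    finally show False using \<open>0 < (norm w)\<^sup>2\<close> by linarith
  qed
  then have "A y = \<mu> *\<^sub>R y" by (simp add: w_def)
  with y bound show thesis by (intro that)
qed

text \<open>
  Move \<open>\<zeta>\<close> along \<open>\<gamma>\<close> until it reaches the boundary of the cone of vectors ordered like \<open>\<gamma>\<close>. There two
  entries agree, and the operator strictly separates them unless the vector is constant.
\<close>

lemma conley_order:
  fixes m \<gamma> \<zeta> :: "'n::finite \<Rightarrow> real"
  assumes m: "\<And>a. m a > 0" and inj: "inj \<gamma>"
    and \<gamma>: "\<And>a. (\<Sum>b\<in>UNIV. m b / \<bar>\<gamma> b - \<gamma> a\<bar> ^ 3 * (\<gamma> b - \<gamma> a)) = - \<Lambda> * \<gamma> a"
    and \<zeta>: "\<And>a. (\<Sum>b\<in>UNIV. m b / \<bar>\<gamma> b - \<gamma> a\<bar> ^ 3 * (\<zeta> b - \<zeta> a)) = \<mu> * \<zeta> a"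
    and \<mu>: "- \<Lambda> \<le> \<mu>"
    and c\<gamma>: "(\<Sum>a\<in>UNIV. m a * \<gamma> a) = 0" and c\<zeta>: "(\<Sum>a\<in>UNIV. m a * \<zeta> a) = 0"
    and orth: "(\<Sum>a\<in>UNIV. m a * (\<zeta> a * \<gamma> a)) = 0"
    and descent: "\<gamma> a0 < \<gamma> b0" "\<zeta> b0 \<le> \<zeta> a0"
  shows "\<zeta> a = 0"
proof -
  define P where "P = {(a, b). \<gamma> a < \<gamma> b}"
  define s where "s = (\<lambda>(a, b). (\<zeta> a - \<zeta> b) / (\<gamma> b - \<gamma> a))"
  \<comment> \<open>\<kappa> is the least multiple of \<gamma> whose addition to \<zeta> gives a
    vector weakly ordered like \<gamma>. The descent makes it nonnegative, and a maximizing pair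
    becomes a tie of \<open>w\<close>.\<close>
  define \<kappa> where "\<kappa> = Max (s ` P)"
  have fin: "finite (s ` P)" "s ` P \<noteq> {}" using descent by (auto simp: P_def)
  have \<kappa>_ge: "s (a, b) \<le> \<kappa>" if "\<gamma> a < \<gamma> b" for a b
    unfolding \<kappa>_def using fin that by (intro Max_ge) (auto simp: P_def)
  have "0 \<le> s (a0, b0)" using descent by (simp add: s_def)
  with \<kappa>_ge[OF descent(1)] have \<kappa>: "0 \<le> \<kappa>" by simp
  define w where "w a = \<zeta> a + \<kappa> * \<gamma> a" for a
  have mono: "w a \<le> w b" if "\<gamma> a < \<gamma> b" for a b
    using \<kappa>_ge[OF that] that by (simp add: w_def s_def pos_divide_le_eq algebra_simps)
  from Max_in[OF fin] obtain a b where ab: "\<gamma> a < \<gamma> b" "\<kappa> = s (a, b)"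
    by (auto simp: \<kappa>_def P_def)
  then have gap: "\<zeta> a - \<zeta> b = \<kappa> * (\<gamma> b - \<gamma> a)" by (simp add: s_def)
  then have wab: "w b = w a" by (simp add: w_def algebra_simps)
  \<comment> \<open>\<open>D\<close> compares the rows \<open>b\<close> and \<open>a\<close> of the
    operator at \<open>w\<close>, body by body. The eigenvalue equations give it a nonpositive sum,
    the ordering makes every term nonnegative.\<close>
  define D where "D e = m e / \<bar>\<gamma> e - \<gamma> b\<bar> ^ 3 * (w e - w b) - m e / \<bar>\<gamma> e - \<gamma> a\<bar> ^ 3 * (w e - w a)" for e
  have "(\<Sum>e\<in>UNIV. m e / \<bar>\<gamma> e - \<gamma> x\<bar> ^ 3 * (w e - w x)) = \<mu> * \<zeta> x - \<kappa> * \<Lambda> * \<gamma> x" for x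
  proof -
    have "(\<Sum>e\<in>UNIV. m e / \<bar>\<gamma> e - \<gamma> x\<bar> ^ 3 * (w e - w x))
      = (\<Sum>e\<in>UNIV. m e / \<bar>\<gamma> e - \<gamma> x\<bar> ^ 3 * (\<zeta> e - \<zeta> x)
          + \<kappa> * (m e / \<bar>\<gamma> e - \<gamma> x\<bar> ^ 3 * (\<gamma> e - \<gamma> x)))"
    proof (intro sum.cong refl)
      show "k * (w e - w x) = k * (\<zeta> e - \<zeta> x) + \<kappa> * (k * (\<gamma> e - \<gamma> x))" for e k
        by (simp add: w_def algebra_simps)
    qed
    also have "\<dots> = \<mu> * \<zeta> x - \<kappa> * \<Lambda> * \<gamma> x"
      unfolding sum.distrib sum_distrib_left[symmetric] \<gamma> \<zeta> by simp
    finally show ?thesis .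
  qed
  then have "sum D UNIV = \<mu> * (\<zeta> b - \<zeta> a) - \<kappa> * \<Lambda> * (\<gamma> b - \<gamma> a)"
    unfolding D_def sum_subtractf by (simp add: algebra_simps)
  also have "\<dots> = - ((\<mu> + \<Lambda>) * (\<kappa> * (\<gamma> b - \<gamma> a)))"
    unfolding minus_diff_eq[of "\<zeta> a" "\<zeta> b", symmetric] gap by (simp add: algebra_simps)
  also have "\<dots> \<le> 0" using \<mu> \<kappa> ab by simp
  finally have D_le: "sum D UNIV \<le> 0" .
  have D: "0 \<le> D e \<and> (D e = 0 \<longrightarrow> w e = w a)" for e
  proof -
    have D_eq: "D e = m e * (w e - w a) * (1 / \<bar>\<gamma> e - \<gamma> b\<bar> ^ 3 - 1 / \<bar>\<gamma> e - \<gamma> a\<bar> ^ 3)"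
      unfolding D_def wab by (simp add: algebra_simps)
    have inv: "1 / y ^ 3 < 1 / x ^ 3" if "0 < x" "x < y" for x y :: real
      using that by (intro divide_strict_left_mono power_strict_mono) auto
    \<comment> \<open>A body from \<open>a\<close> to \<open>b\<close> has \<open>w\<close> squeezed
      between the two tied values. One beyond \<open>b\<close> is closer to \<open>b\<close>, one
      beyond \<open>a\<close> is closer to \<open>a\<close>; in both cases the two factors in
      \<open>D_eq\<close> never have opposite signs.\<close>
    consider "\<gamma> b < \<gamma> e" | "\<gamma> e < \<gamma> a" | "w e = w a"
      using mono[of a e] mono[of e b] wab injD[OF inj, of e a] injD[OF inj, of e b] by fastforce
    then show ?thesis
    proof cases
      case 1
      then have "0 \<le> w e - w a" using mono[of b e] wab by simp
      moreover have "0 < 1 / \<bar>\<gamma> e - \<gamma> b\<bar> ^ 3 - 1 / \<bar>\<gamma> e - \<gamma> a\<bar> ^ 3"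
        using inv[of "\<bar>\<gamma> e - \<gamma> b\<bar>" "\<bar>\<gamma> e - \<gamma> a\<bar>"] 1 ab by simp
      ultimately show ?thesis unfolding D_eq using m[of e] by auto
    next
      case 2
      then have "w e - w a \<le> 0" using mono[of e a] by simp
      moreover have "1 / \<bar>\<gamma> e - \<gamma> b\<bar> ^ 3 - 1 / \<bar>\<gamma> e - \<gamma> a\<bar> ^ 3 < 0"
        using inv[of "\<bar>\<gamma> e - \<gamma> a\<bar>" "\<bar>\<gamma> e - \<gamma> b\<bar>"] 2 ab by simp
      ultimately show ?thesis unfolding D_eq using m[of e]
        by (auto simp: mult_nonneg_nonpos intro!: mult_nonpos_nonpos)
    next
      case 3 then show ?thesis by (simp add: D_eq)
    qed
  qed
  have "sum D UNIV = 0" using D_le sum_nonneg[of UNIV D] D by (simp add: order_antisym)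
  then have "D e = 0" for e using D sum_nonneg_eq_0_iff[of UNIV D] by auto
  then have const: "w e = w a" for e using D by blast
  \<comment> \<open>A constant vector with weighted mean zero vanishes, so \<zeta> is a multiple of
    \<gamma>, and orthogonality removes that multiple.\<close>
  have "0 = (\<Sum>e\<in>UNIV. m e * w e)"
    using c\<gamma> c\<zeta> unfolding w_def
    by (simp add: distrib_left sum.distrib mult.left_commute[of _ \<kappa>] flip: sum_distrib_left)
  also have "\<dots> = (\<Sum>e\<in>UNIV. m e * w a)" by (intro sum.cong refl arg_cong[OF const])
  finally have "sum m UNIV * w a = 0" by (simp add: sum_distrib_right)
  moreover have "sum m UNIV > 0" using m by (intro sum_pos) auto
  ultimately have "w a = 0" by simp
  then have "w e = 0" for e by (rule trans[OF const])
  then have \<zeta>_eq: "\<zeta> e = - \<kappa> * \<gamma> e" for e by (simp add: w_def eq_neg_iff_add_eq_0)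
  have "\<kappa> * (\<Sum>e\<in>UNIV. m e * (\<gamma> e)\<^sup>2) = 0"
    using orth unfolding \<zeta>_eq sum_distrib_left
    by (simp add: power2_eq_square sum_negf algebra_simps)
  moreover have "(\<Sum>e\<in>UNIV. m e * (\<gamma> e)\<^sup>2) \<noteq> 0"
  proof
    assume "(\<Sum>e\<in>UNIV. m e * (\<gamma> e)\<^sup>2) = 0"
    then have "\<gamma> e = 0" for e
      using sum_nonneg_eq_0_iff[of UNIV "\<lambda>e. m e * (\<gamma> e)\<^sup>2"] m by (auto simp: less_imp_le less_imp_neq[THEN not_sym])
    with ab show False by simp
  qed
  ultimately have "\<kappa> = 0" by simp
  then show ?thesis by (simp add: \<zeta>_eq)
qed


section \<open>Pair interaction operators in mass-weighted coordinates\<close>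

text \<open>
  The coordinates of a configuration along a fixed direction, weighted by \<open>sqrt (m a)\<close>, turn the mass
  inner product into the Euclidean one. In these coordinates Newton's equations are linear with the
  coefficients \<open>kernel q\<close>; the diagonal \<open>kernel q a a = 1 / 0 = 0\<close> is harmless.
\<close>

definition pair_op :: "('n \<Rightarrow> real) \<Rightarrow> ('n \<Rightarrow> 'n \<Rightarrow> real) \<Rightarrow> real^'n \<Rightarrow> real^'n" where
  "pair_op m k z = (\<chi> a. \<Sum>b\<in>UNIV. sqrt (m a) * m b * k a b * (z $ b / sqrt (m b) - z $ a / sqrt (m a)))"

definition weighted :: "('n \<Rightarrow> real) \<Rightarrow> real^'d \<Rightarrow> real^'d^'n \<Rightarrow> real^'n" where
  "weighted m e q = (\<chi> a. sqrt (m a) * (q $ a \<bullet> e))"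

definition kernel :: "real^'d^'n \<Rightarrow> 'n \<Rightarrow> 'n \<Rightarrow> real" where
  "kernel q a b = 1 / norm (q $ b - q $ a) ^ 3"

definition newton_force :: "('n \<Rightarrow> real) \<Rightarrow> real^'d^'n \<Rightarrow> real^'d^'n" where
  "newton_force m q = (\<chi> a. \<Sum>b\<in>UNIV. (m b * kernel q a b) *\<^sub>R (q $ b - q $ a))"

lemma kernel_sym: "kernel q a b = kernel q b a"
  by (simp add: kernel_def norm_minus_commute)

lemma linear_pair_op: "linear (pair_op m k)"
proof (rule linearI)
  have "\<kappa> * ((x + y) / s - (x' + y') / s') = \<kappa> * (x / s - x' / s') + \<kappa> * (y / s - y' / s')"
    for \<kappa> x y x' y' s s' :: real
    by (simp add: add_divide_distrib algebra_simps)
  then show "pair_op m k (x + y) = pair_op m k x + pair_op m k y" for x y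
    by (simp only: pair_op_def vec_eq_iff vector_add_component vec_lambda_beta simp_thms flip: sum.distrib)
  have "\<kappa> * (r * x / s - r * x' / s') = r * (\<kappa> * (x / s - x' / s'))" for \<kappa> x x' s s' r :: real
    by (simp add: algebra_simps)
  then show "pair_op m k (r *\<^sub>R x) = r *\<^sub>R pair_op m k x" for r x
    by (simp only: pair_op_def vec_eq_iff vector_scaleR_component real_scaleR_def vec_lambda_beta
        simp_thms sum_distrib_left)
qed

lemma pair_op_diff_kernel: "pair_op m k z - pair_op m l z = pair_op m (\<lambda>a b. k a b - l a b) z"
  by (simp add: pair_op_def vec_eq_iff algebra_simps flip: sum_subtractf)

lemma double_sum_symmetrize:
  fixes g :: "'n::finite \<Rightarrow> 'n \<Rightarrow> real"
  shows "(\<Sum>a\<in>UNIV. \<Sum>b\<in>UNIV. g a b) = (\<Sum>a\<in>UNIV. \<Sum>b\<in>UNIV. g a b + g b a) / 2"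
  unfolding sum.distrib using sum.swap[of g UNIV UNIV] by simp

text \<open>The Dirichlet form of a weighted graph Laplacian, conjugated by the square roots of the
  masses; its symmetry in \<open>y\<close> and \<open>z\<close> gives self-adjointness.\<close>

lemma pair_op_inner:
  fixes m :: "'n::finite \<Rightarrow> real"
  assumes m: "\<And>a. m a > 0" and k: "\<And>a b. k a b = k b a"
  shows "pair_op m k y \<bullet> z = - (\<Sum>a\<in>UNIV. \<Sum>b\<in>UNIV. m a * m b * k a b *
           ((y $ b / sqrt (m b) - y $ a / sqrt (m a)) * (z $ b / sqrt (m b) - z $ a / sqrt (m a)))) / 2"
proof -
  define \<eta> \<zeta> where "\<eta> a = y $ a / sqrt (m a)" and "\<zeta> a = z $ a / sqrt (m a)" for a
  have sq: "sqrt (m a) * z $ a = m a * \<zeta> a" for a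
    using m[of a] by (simp add: \<zeta>_def real_div_sqrt flip: times_divide_eq_left times_divide_eq_right)
      (metis less_imp_le mult.commute real_div_sqrt times_divide_eq_left)
  have "pair_op m k y \<bullet> z = (\<Sum>a\<in>UNIV. \<Sum>b\<in>UNIV. m b * k a b * (\<eta> b - \<eta> a) * (sqrt (m a) * z $ a))"
    by (simp add: inner_vec_def pair_op_def \<eta>_def[symmetric] sum_distrib_right sum_distrib_left
        algebra_simps)
  also have "\<dots> = (\<Sum>a\<in>UNIV. \<Sum>b\<in>UNIV. m b * k a b * (\<eta> b - \<eta> a) * (m a * \<zeta> a)
        + m a * k b a * (\<eta> a - \<eta> b) * (m b * \<zeta> b)) / 2"
    unfolding sq by (rule double_sum_symmetrize)
  also have "(\<Sum>a\<in>UNIV. \<Sum>b\<in>UNIV. m b * k a b * (\<eta> b - \<eta> a) * (m a * \<zeta> a)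
        + m a * k b a * (\<eta> a - \<eta> b) * (m b * \<zeta> b))
     = (\<Sum>a\<in>UNIV. \<Sum>b\<in>UNIV. - (m a * m b * k a b * ((\<eta> b - \<eta> a) * (\<zeta> b - \<zeta> a))))"
  proof (intro sum.cong refl)
    fix a b
    show "m b * k a b * (\<eta> b - \<eta> a) * (m a * \<zeta> a) + m a * k b a * (\<eta> a - \<eta> b) * (m b * \<zeta> b)
        = - (m a * m b * k a b * ((\<eta> b - \<eta> a) * (\<zeta> b - \<zeta> a)))"
      unfolding k[of b a] by (simp add: algebra_simps)
  qed
  finally show ?thesis by (simp add: sum_negf \<eta>_def \<zeta>_def)
qed

lemma pair_op_self_adjoint:
  fixes m :: "'n::finite \<Rightarrow> real"
  assumes m: "\<And>a. m a > 0" and k: "\<And>a b. k a b = k b a"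
  shows "pair_op m k y \<bullet> z = y \<bullet> pair_op m k z"
  unfolding inner_commute[of y] pair_op_inner[of m k, OF m k] by (simp add: mult.commute)

text \<open>A crude operator bound suffices: it is continuous in the entries of \<open>k\<close>,
  and applied to a difference of kernels it tends to 0 when the kernels converge.\<close>

definition pair_bound :: "('n::finite \<Rightarrow> real) \<Rightarrow> ('n \<Rightarrow> 'n \<Rightarrow> real) \<Rightarrow> real" where
  "pair_bound m k =
    (\<Sum>a\<in>UNIV. \<Sum>b\<in>UNIV. sqrt (m a) * m b * \<bar>k a b\<bar> * (1 / sqrt (m b) + 1 / sqrt (m a)))"

lemma norm_pair_op_le:
  fixes m :: "'n::finite \<Rightarrow> real"
  assumes m: "\<And>a. m a > 0"
  shows "norm (pair_op m k z) \<le> pair_bound m k * norm z"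
proof -
  have "norm (pair_op m k z) \<le> (\<Sum>a\<in>UNIV. \<bar>pair_op m k z $ a\<bar>)" by (rule norm_le_l1_cart)
  also have "\<dots> \<le> (\<Sum>a\<in>UNIV. \<Sum>b\<in>UNIV.
      sqrt (m a) * m b * \<bar>k a b\<bar> * (1 / sqrt (m b) + 1 / sqrt (m a)) * norm z)"
  proof (rule sum_mono)
    fix a
    have "\<bar>pair_op m k z $ a\<bar> \<le> (\<Sum>b\<in>UNIV.
        \<bar>sqrt (m a) * m b * k a b * (z $ b / sqrt (m b) - z $ a / sqrt (m a))\<bar>)"
      by (simp add: pair_op_def sum_abs)
    also have "\<dots> \<le> (\<Sum>b\<in>UNIV. sqrt (m a) * m b * \<bar>k a b\<bar> * ((1 / sqrt (m b) + 1 / sqrt (m a)) * norm z))"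
    proof (rule sum_mono)
      fix b
      have quot: "\<bar>z $ c / sqrt (m c)\<bar> \<le> 1 / sqrt (m c) * norm z" for c
        using m[of c] component_le_norm_cart[of z c] by (simp add: abs_div divide_right_mono)
      have "\<bar>z $ b / sqrt (m b) - z $ a / sqrt (m a)\<bar> \<le> (1 / sqrt (m b) + 1 / sqrt (m a)) * norm z"
        using quot[of a] quot[of b] unfolding distrib_right by linarith
      then show "\<bar>sqrt (m a) * m b * k a b * (z $ b / sqrt (m b) - z $ a / sqrt (m a))\<bar>
          \<le> sqrt (m a) * m b * \<bar>k a b\<bar> * ((1 / sqrt (m b) + 1 / sqrt (m a)) * norm z)"
        unfolding abs_mult using m[of a] m[of b] by (intro mult_mono) auto
    qed
    finally show "\<bar>pair_op m k z $ a\<bar> \<le> (\<Sum>b\<in>UNIV.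
      sqrt (m a) * m b * \<bar>k a b\<bar> * (1 / sqrt (m b) + 1 / sqrt (m a)) * norm z)"
      by (simp add: mult.assoc)
  qed
  finally show ?thesis by (simp add: pair_bound_def sum_distrib_right)
qed

text \<open>The center-of-mass condition in the coordinates \<open>weighted\<close>: orthogonality
  to the vector of the \<open>sqrt (m a)\<close>, which represents translations.\<close>

definition weight_orth :: "('n::finite \<Rightarrow> real) \<Rightarrow> (real^'n) set" where
  "weight_orth m = {z. (\<Sum>a\<in>UNIV. sqrt (m a) * z $ a) = 0}"

lemma subspace_weight_orth: "subspace (weight_orth m)"
  unfolding subspace_def weight_orth_def
  by (auto simp: distrib_left sum.distrib mult.left_commute[of _ "_::real"] simp flip: sum_distrib_left)

text \<open>Translations lie in the kernel of the operator, so by self-adjointness its range is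
  orthogonal to them.\<close>

lemma pair_op_weight_orth:
  fixes m :: "'n::finite \<Rightarrow> real"
  assumes m: "\<And>a. m a > 0" and k: "\<And>a b. k a b = k b a"
  shows "pair_op m k z \<in> weight_orth m"
proof -
  define w where "w = (\<chi> a. sqrt (m a))"
  have "m a \<noteq> 0" for a using m[of a] by simp
  then have "pair_op m k w = 0" by (simp add: pair_op_def w_def vec_eq_iff)
  then have "pair_op m k z \<bullet> w = 0" using pair_op_self_adjoint[of m k z w, OF m k] by simp
  then show ?thesis by (simp add: weight_orth_def w_def inner_vec_def mult.commute)
qed

text \<open>Let \<mu> be the top eigenvalue on the centered vectors orthogonal to \<open>c\<close>.
  If it were at least -\<Lambda>, the order argument would annihilate its eigenvector. Hence \<mu> <
  -\<Lambda>, and the gap -\<Lambda> - \<mu> serves as \<delta>.\<close>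

lemma conley_coercive:
  fixes m \<gamma> :: "'n::finite \<Rightarrow> real"
  assumes m: "\<And>a. m a > 0" and inj: "inj \<gamma>" and cent: "(\<Sum>a\<in>UNIV. m a * \<gamma> a) = 0"
    and k: "\<And>a b. k a b = 1 / \<bar>\<gamma> b - \<gamma> a\<bar> ^ 3"
    and c: "c = (\<chi> a. sqrt (m a) * \<gamma> a)" and eig: "pair_op m k c = - \<Lambda> *\<^sub>R c"
  obtains \<delta> where "\<delta> > 0"
    "\<And>y. y \<in> weight_orth m \<Longrightarrow> y \<bullet> c = 0 \<Longrightarrow> \<delta> * (norm y)\<^sup>2 \<le> - (\<Lambda> *\<^sub>R y + pair_op m k y) \<bullet> y"
proof -
  define E where "E = weight_orth m \<inter> {y. c \<bullet> y = 0}"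
  have E: "subspace E"
    unfolding E_def by (intro subspace_inter subspace_weight_orth subspace_hyperplane)
  have ksym: "k a b = k b a" for a b by (simp add: k abs_minus_commute)
  show thesis
  proof (cases "E \<subseteq> {0}")
    case True
    \<comment> \<open>On a trivial complement, as for two bodies, any positive constant
      works.\<close>
    then show thesis by (intro that[of 1]) (auto simp: E_def inner_commute)
  next
    case False
    then obtain x0 where x0: "x0 \<in> E" "x0 \<noteq> 0" by auto
    have inv: "pair_op m k x \<in> E" if "x \<in> E" for x
      using that pair_op_weight_orth[of m k, OF m ksym] pair_op_self_adjoint[of m k c x, OF m ksym]
      by (simp add: E_def eig)
    obtain y \<mu> where y: "y \<in> E" "norm y = 1" "pair_op m k y = \<mu> *\<^sub>R y"
      and max: "\<And>z. z \<in> E \<Longrightarrow> pair_op m k z \<bullet> z \<le> \<mu> * (norm z)\<^sup>2"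
      using rayleigh_maximizer[OF linear_pair_op pair_op_self_adjoint[of m k, OF m ksym] E inv x0] by blast
    have scalar: "(\<Sum>b\<in>UNIV. m b / \<bar>\<gamma> b - \<gamma> a\<bar> ^ 3 * (z $ b / sqrt (m b) - z $ a / sqrt (m a)))
        = \<rho> * (z $ a / sqrt (m a))" if "pair_op m k z = \<rho> *\<^sub>R z" for z \<rho> a
    proof -
      have "sqrt (m a) * (\<Sum>b\<in>UNIV. m b / \<bar>\<gamma> b - \<gamma> a\<bar> ^ 3 * (z $ b / sqrt (m b) - z $ a / sqrt (m a)))
          = pair_op m k z $ a"
        by (simp add: pair_op_def k sum_distrib_left mult.assoc)
      also have "\<dots> = \<rho> * z $ a" by (simp add: that)
      finally show ?thesis using m[of a] by (simp add: field_simps)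
    qed
    have m0: "m a \<noteq> 0" "sqrt (m a) * sqrt (m a) = m a" for a using m[of a] by simp_all
    define \<zeta> where "\<zeta> a = y $ a / sqrt (m a)" for a
    have y_eq: "y $ a = sqrt (m a) * \<zeta> a" for a using m0 by (simp add: \<zeta>_def)
    have c\<zeta>: "(\<Sum>a\<in>UNIV. m a * \<zeta> a) = 0"
      using y(1) by (simp add: E_def weight_orth_def y_eq abs_of_pos[OF m] flip: mult.assoc)
    have "c \<bullet> y = (\<Sum>a\<in>UNIV. m a * (\<zeta> a * \<gamma> a))"
      unfolding inner_vec_def c
    proof (intro sum.cong refl)
      fix a
      have "(\<chi> a. sqrt (m a) * \<gamma> a) $ a \<bullet> y $ a = sqrt (m a) * sqrt (m a) * (\<zeta> a * \<gamma> a)"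
        unfolding y_eq by (simp del: real_sqrt_mult_self)
      then show "(\<chi> a. sqrt (m a) * \<gamma> a) $ a \<bullet> y $ a = m a * (\<zeta> a * \<gamma> a)"
        unfolding m0(2) .
    qed
    then have orth: "(\<Sum>a\<in>UNIV. m a * (\<zeta> a * \<gamma> a)) = 0" using y(1) by (simp add: E_def)
    have eq\<gamma>: "(\<Sum>b\<in>UNIV. m b / \<bar>\<gamma> b - \<gamma> a\<bar> ^ 3 * (\<gamma> b - \<gamma> a)) = - \<Lambda> * \<gamma> a" for a
      using scalar[OF eig, of a] m0 by (simp add: c)
    have eq\<zeta>: "(\<Sum>b\<in>UNIV. m b / \<bar>\<gamma> b - \<gamma> a\<bar> ^ 3 * (\<zeta> b - \<zeta> a)) = \<mu> * \<zeta> a" for a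
      using scalar[OF y(3), of a] by (simp add: \<zeta>_def)
    have "\<mu> < - \<Lambda>"
    proof (rule ccontr)
      assume "\<not> \<mu> < - \<Lambda>"
      then have \<mu>: "- \<Lambda> \<le> \<mu>" by simp
      have "\<zeta> a = 0" for a
      proof (cases "\<exists>a b. \<gamma> a < \<gamma> b \<and> \<zeta> b \<le> \<zeta> a")
        case True
        then show ?thesis
          using conley_order[of m \<gamma> \<Lambda> \<zeta> \<mu>, OF m inj eq\<gamma> eq\<zeta> \<mu> cent c\<zeta> orth] by blast
      next
        \<comment> \<open>Without a descent \<zeta> increases strictly with \<gamma>, so its
          negative, which solves the same equations, has one.\<close>
        case no_descent: False
        show ?thesis
        proof (cases "\<exists>a b. \<gamma> a < \<gamma> b")
          case True
          then obtain a0 b0 where ab: "\<gamma> a0 < \<gamma> b0" by blast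
          with no_descent have "- \<zeta> b0 \<le> - \<zeta> a0" by force
          moreover have "(\<Sum>b\<in>UNIV. m b / \<bar>\<gamma> b - \<gamma> x\<bar> ^ 3 * (- \<zeta> b - - \<zeta> x)) = \<mu> * - \<zeta> x" for x
          proof -
            have "k * (- \<zeta> b - - \<zeta> x) = - (k * (\<zeta> b - \<zeta> x))" for k b by (simp add: algebra_simps)
            then show ?thesis by (simp only: sum_negf eq\<zeta> mult_minus_right)
          qed
          moreover have "(\<Sum>a\<in>UNIV. m a * - \<zeta> a) = 0" "(\<Sum>a\<in>UNIV. m a * (- \<zeta> a * \<gamma> a)) = 0"
            using c\<zeta> orth by (simp_all add: sum_negf)
          ultimately have "- \<zeta> a = 0"
            using conley_order[of m \<gamma> \<Lambda> "\<lambda>a. - \<zeta> a" \<mu> a0 b0 a, OF m inj eq\<gamma> _ \<mu> cent _ _ ab] by blast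
          then show ?thesis by simp
        next
          case False
          have "b = a" for b
            using False injD[OF inj, of a b] by (metis linorder_neqE_linordered_idom)
          then have "UNIV = {a}" by auto
          from c\<zeta> have "m a * \<zeta> a = 0" unfolding \<open>UNIV = {a}\<close> by simp
          with m0(1)[of a] show ?thesis by simp
        qed
      qed
      then have "y = 0" by (simp add: vec_eq_iff y_eq)
      with y show False by simp
    qed
    then show thesis
      using max by (intro that[of "- \<Lambda> - \<mu>"])
        (auto simp: E_def inner_commute inner_add_left power2_norm_eq_inner algebra_simps)
  qed
qed


section \<open>The Newtonian potential\<close>

text \<open>Symmetry of the pair terms frees the sum from the order on bodies; the added diagonal
  terms are 0 because division by 0 gives 0.\<close>

lemma newton_U_double:
  fixes q :: "real^'d^('n::{finite,linorder})"
  shows "newton_U m q = (\<Sum>a\<in>UNIV. \<Sum>b\<in>UNIV. m a * m b / norm (q $ a - q $ b)) / 2"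
proof -
  define g where "g = (\<lambda>(a, b). m a * m b / norm (q $ a - q $ b))"
  let ?L = "{(a, b). a < b}" and ?G = "{(a, b). b < a}" and ?D = "{(a, b). a = (b::'n)}"
  have "(UNIV :: ('n \<times> 'n) set) = (?L \<union> ?G) \<union> ?D" by auto
  then have "sum g UNIV = sum g ((?L \<union> ?G) \<union> ?D)" by simp
  also have "\<dots> = sum g (?L \<union> ?G) + sum g ?D" by (intro sum.union_disjoint) auto
  also have "sum g (?L \<union> ?G) = sum g ?L + sum g ?G" by (intro sum.union_disjoint) auto
  also have "sum g ?D = 0" by (intro sum.neutral) (auto simp: g_def)
  also have "sum g ?G = sum g ?L"
    by (rule sum.reindex_bij_witness[of _ prod.swap prod.swap])
      (auto simp: g_def norm_minus_commute mult.commute)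
  also have "sum g ?L = newton_U m q" by (simp add: newton_U_def g_def)
  finally show ?thesis by (simp add: g_def sum.cartesian_product)
qed

lemma mass_inner_newton_force:
  fixes q h :: "real^'d^'n"
  shows "mass_inner m (newton_force m q) h =
    (\<Sum>a\<in>UNIV. \<Sum>b\<in>UNIV. - (m a * m b * kernel q a b * ((q $ a - q $ b) \<bullet> (h $ a - h $ b)))) / 2"
proof -
  have "mass_inner m (newton_force m q) h
      = (\<Sum>a\<in>UNIV. \<Sum>b\<in>UNIV. m a * m b * kernel q a b * ((q $ b - q $ a) \<bullet> h $ a))"
    by (simp add: mass_inner_def newton_force_def inner_sum_left sum_distrib_left mult.assoc)
  also have "\<dots> = (\<Sum>a\<in>UNIV. \<Sum>b\<in>UNIV. m a * m b * kernel q a b * ((q $ b - q $ a) \<bullet> h $ a)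
      + m b * m a * kernel q b a * ((q $ a - q $ b) \<bullet> h $ b)) / 2"
    by (rule double_sum_symmetrize)
  also have "(\<Sum>a\<in>UNIV. \<Sum>b\<in>UNIV. m a * m b * kernel q a b * ((q $ b - q $ a) \<bullet> h $ a)
      + m b * m a * kernel q b a * ((q $ a - q $ b) \<bullet> h $ b))
    = (\<Sum>a\<in>UNIV. \<Sum>b\<in>UNIV. - (m a * m b * kernel q a b * ((q $ a - q $ b) \<bullet> (h $ a - h $ b))))"
  proof (intro sum.cong refl)
    fix a b
    show "m a * m b * kernel q a b * ((q $ b - q $ a) \<bullet> h $ a)
      + m b * m a * kernel q b a * ((q $ a - q $ b) \<bullet> h $ b)
      = - (m a * m b * kernel q a b * ((q $ a - q $ b) \<bullet> (h $ a - h $ b)))"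
      unfolding kernel_sym[of q b a] by (simp add: inner_diff_left inner_diff_right algebra_simps)
  qed
  finally show ?thesis .
qed

lemma has_mass_gradient_newton_U:
  fixes q :: "real^'d^('n::{finite,linorder})"
  assumes q: "collision_free q"
  shows "has_mass_gradient m (newton_U m) (newton_force m q) q"
proof -
  have pair: "((\<lambda>q. m a * m b / norm (q $ a - q $ b)) has_derivative
      (\<lambda>h. - (m a * m b * kernel q a b * ((q $ a - q $ b) \<bullet> (h $ a - h $ b))))) (at q)" for a b
  proof (cases "a = b")
    case False
    then have nz: "q $ a - q $ b \<noteq> 0" using q by (auto simp: collision_free_def)
    have "((\<lambda>q. q $ a - q $ b) has_derivative (\<lambda>h. h $ a - h $ b)) (at q)"
      by (intro bounded_linear_imp_has_derivative bounded_linear_sub bounded_linear_vec_nth)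
    from has_derivative_compose[OF this has_derivative_norm[OF nz]]
    have n: "((\<lambda>q. norm (q $ a - q $ b)) has_derivative
        (\<lambda>h. (h $ a - h $ b) \<bullet> sgn (q $ a - q $ b))) (at q)"
      by (simp add: inner_commute)
    have n0: "norm (q $ a - q $ b) \<noteq> 0" using nz by simp
    define z where "z = q $ a - q $ b"
    have k: "kernel q a b = 1 / norm z ^ 3" by (simp add: kernel_def z_def norm_minus_commute)
    show ?thesis
      unfolding k z_def[symmetric]
      by (rule has_derivative_eq_rhs[OF has_derivative_divide[OF has_derivative_const n n0]])
        (unfold z_def[symmetric], simp add: sgn_div_norm inner_commute[of z] power3_eq_cube
          divide_inverse mult_ac)
  qed simp
  have "((\<lambda>q. (\<Sum>a\<in>UNIV. \<Sum>b\<in>UNIV. m a * m b / norm (q $ a - q $ b)) / 2) has_derivative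
      mass_inner m (newton_force m q)) (at q)"
    by (rule has_derivative_eq_rhs[OF bounded_linear.has_derivative[OF bounded_linear_divide
            has_derivative_sum[OF has_derivative_sum[OF pair]]]])
      (simp add: mass_inner_newton_force fun_eq_iff)
  then show ?thesis unfolding has_mass_gradient_def newton_U_double[abs_def] .
qed

lemma mass_inner_self_pos:
  fixes q :: "real^'d^'n"
  assumes m: "\<And>a. m a > 0" and q: "q \<noteq> 0"
  shows "0 < mass_inner m q q"
proof -
  obtain a where "q $ a \<noteq> 0" using q by (auto simp: vec_eq_iff)
  then have "0 < m a * (q $ a \<bullet> q $ a)" using m[of a] by simp
  also have "\<dots> \<le> mass_inner m q q"
    unfolding mass_inner_def using m by (intro member_le_sum) (auto simp: less_imp_le)
  finally show ?thesis .
qed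

lemma mass_inner_simps:
  shows "mass_inner m (x + y) z = mass_inner m x z + mass_inner m y z"
    and "mass_inner m (x - y) z = mass_inner m x z - mass_inner m y z"
    and "mass_inner m (r *\<^sub>R x) z = r * mass_inner m x z"
    and "mass_inner m z (x + y) = mass_inner m z x + mass_inner m z y"
    and "mass_inner m z (x - y) = mass_inner m z x - mass_inner m z y"
    and "mass_inner m z (r *\<^sub>R x) = r * mass_inner m z x"
  by (simp_all add: mass_inner_def inner_add_left inner_add_right inner_diff_left inner_diff_right
      distrib_left right_diff_distrib sum.distrib sum_subtractf sum_distrib_left mult.left_commute)

lemma mass_inner_commute: "mass_inner m x y = mass_inner m y x"
  by (simp add: mass_inner_def inner_commute)

text \<open>Identifies the gradient that \<open>newton_solution\<close> only asserts to exist with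
  the explicit force.\<close>

lemma has_mass_gradient_unique:
  assumes m: "\<And>a. m a > 0"
    and "has_mass_gradient m f g q" "has_mass_gradient m f g' q"
  shows "g = g'"
proof (rule ccontr)
  assume "g \<noteq> g'"
  then have "0 < mass_inner m (g - g') (g - g')" by (intro mass_inner_self_pos m) auto
  moreover have "mass_inner m g = mass_inner m g'"
    using assms(2,3) unfolding has_mass_gradient_def by (rule has_derivative_unique)
  ultimately show False by (simp add: mass_inner_simps)
qed

lemma bounded_linear_weighted: "bounded_linear (weighted m e :: real^'d^'n \<Rightarrow> real^'n)"
proof (rule linear_conv_bounded_linear[THEN iffD1], rule linearI)
  show "weighted m e (x + y) = weighted m e x + weighted m e y" for x y :: "real^'d^'n"
    by (simp add: weighted_def vec_eq_iff inner_add_left distrib_left)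
  show "weighted m e (r *\<^sub>R x) = r *\<^sub>R weighted m e x" for r and x :: "real^'d^'n"
    by (simp add: weighted_def vec_eq_iff)
qed

text \<open>Source of the a priori bounds: every coordinate of position or velocity is controlled by
  a mass norm, however the configuration rotates.\<close>

lemma norm_weighted_le:
  assumes m: "\<And>a. m a > 0"
  shows "norm (weighted m e q) \<le> norm e * mass_norm m q"
proof (rule power2_le_imp_le)
  have q: "0 \<le> mass_inner m q q"
    using m by (auto simp: mass_inner_def less_imp_le intro!: sum_nonneg)
  then show "0 \<le> norm e * mass_norm m q" by (simp add: mass_norm_def)
  have "(norm (weighted m e q))\<^sup>2 = (\<Sum>a\<in>UNIV. m a * (q $ a \<bullet> e)\<^sup>2)"
    unfolding power2_norm_eq_inner inner_vec_def weighted_def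
    using m by (intro sum.cong) (simp_all add: less_imp_le power2_eq_square[symmetric] power_mult_distrib)
  also have "\<dots> \<le> (\<Sum>a\<in>UNIV. m a * ((q $ a \<bullet> q $ a) * (e \<bullet> e)))"
    using m by (intro sum_mono mult_left_mono Cauchy_Schwarz_ineq) (auto simp: less_imp_le)
  also have "\<dots> = (e \<bullet> e) * mass_inner m q q"
    by (simp add: mass_inner_def sum_distrib_left mult_ac)
  also have "\<dots> = (norm e * mass_norm m q)\<^sup>2"
    using q by (simp add: power_mult_distrib power2_norm_eq_inner mass_norm_def)
  finally show "(norm (weighted m e q))\<^sup>2 \<le> (norm e * mass_norm m q)\<^sup>2" .
qed

lemma weighted_newton_force:
  assumes m: "\<And>a. m a > 0"
  shows "weighted m e (newton_force m q) = pair_op m (kernel q) (weighted m e q)"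
proof -
  have "m a \<noteq> 0" for a using m[of a] by simp
  then show ?thesis
    by (simp add: weighted_def newton_force_def pair_op_def vec_eq_iff inner_sum_left inner_diff_left
        sum_distrib_left mult.assoc)
qed

lemma weighted_centered: "q \<in> centered m \<Longrightarrow> (\<And>a. m a > 0) \<Longrightarrow> weighted m e q \<in> weight_orth m"
proof -
  assume q: "q \<in> centered m" and m: "\<And>a. m a > 0"
  have "(\<Sum>a\<in>UNIV. sqrt (m a) * weighted m e q $ a) = (\<Sum>a\<in>UNIV. m a * (q $ a \<bullet> e))"
    using m by (simp add: weighted_def abs_of_pos flip: mult.assoc)
  also have "\<dots> = (\<Sum>a\<in>UNIV. m a *\<^sub>R q $ a) \<bullet> e" by (simp add: inner_sum_left)
  also have "\<dots> = 0" using q by (simp add: centered_def)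
  finally show ?thesis by (simp add: weight_orth_def)
qed

section \<open>Homogeneity of the potential and the central configuration equation\<close>

lemma norm_component_diff_scale:
  "r > 0 \<Longrightarrow> norm ((q /\<^sub>R r) $ a - (q /\<^sub>R r) $ b) = norm (q $ a - q $ b) / r"
  unfolding vector_scaleR_component scaleR_diff_right[symmetric] by (simp add: divide_inverse mult.commute)

lemma kernel_scale: "r > 0 \<Longrightarrow> kernel (q /\<^sub>R r) a b = r ^ 3 * kernel q a b"
  unfolding kernel_def norm_component_diff_scale by (simp add: power_divide)

lemma newton_U_scale: "r > 0 \<Longrightarrow> newton_U m (q /\<^sub>R r) = r * newton_U m q"
  unfolding newton_U_def norm_component_diff_scale sum_distrib_left
  by (intro sum.cong refl) (simp add: case_prod_unfold)

text \<open>Euler's identity for the potential, homogeneous of degree -1.\<close>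

lemma newton_force_inner_self:
  fixes q :: "real^'d^('n::{finite,linorder})"
  shows "mass_inner m (newton_force m q) q = - newton_U m q"
proof -
  have "m a * m b * kernel q a b * ((q $ a - q $ b) \<bullet> (q $ a - q $ b)) = m a * m b / norm (q $ a - q $ b)"
    for a b
    by (simp add: kernel_def norm_minus_commute[of "q $ b"] power3_eq_cube power2_eq_square
        flip: power2_norm_eq_inner)
  then show ?thesis by (simp add: mass_inner_newton_force newton_U_double sum_negf)
qed

lemma double_sum_antisym:
  fixes g :: "'n::finite \<Rightarrow> 'n \<Rightarrow> 'b::real_vector"
  assumes g: "\<And>a b. g a b = - g b a"
  shows "(\<Sum>a\<in>UNIV. \<Sum>b\<in>UNIV. g a b) = 0"
proof -
  have "(\<Sum>a\<in>UNIV. \<Sum>b\<in>UNIV. g a b) = (\<Sum>a\<in>UNIV. \<Sum>b\<in>UNIV. - g b a)"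
    by (rule sum.cong[OF refl], rule sum.cong[OF refl], rule g)
  also have "\<dots> = - (\<Sum>b\<in>UNIV. \<Sum>a\<in>UNIV. g a b)" by (simp only: sum_negf)
  also have "(\<Sum>b\<in>UNIV. \<Sum>a\<in>UNIV. g a b) = (\<Sum>a\<in>UNIV. \<Sum>b\<in>UNIV. g a b)" by (rule sum.swap)
  finally have "2 *\<^sub>R (\<Sum>a\<in>UNIV. \<Sum>b\<in>UNIV. g a b) = 0"
    unfolding scaleR_2 by (rule eq_neg_iff_add_eq_0[THEN iffD1])
  then show ?thesis by simp
qed

lemma newton_force_centered: "newton_force m q \<in> centered m"
proof -
  have "(\<Sum>a\<in>UNIV. \<Sum>b\<in>UNIV. (m a * m b * kernel q a b) *\<^sub>R (q $ b - q $ a)) = 0"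
  proof (rule double_sum_antisym)
    fix a b
    have "m a * m b * kernel q a b = m b * m a * kernel q b a"
      by (simp only: kernel_sym[of q a b] mult.commute)
    then show "(m a * m b * kernel q a b) *\<^sub>R (q $ b - q $ a)
        = - ((m b * m a * kernel q b a) *\<^sub>R (q $ a - q $ b))"
      by (simp only: scaleR_minus_right[symmetric] minus_diff_eq)
  qed
  then show ?thesis by (simp add: centered_def newton_force_def scaleR_sum_right mult.assoc)
qed

lemma subspace_centered: "subspace (centered m)"
proof -
  have "(\<Sum>a\<in>UNIV. m a *\<^sub>R (r *\<^sub>R x $ a)) = r *\<^sub>R (\<Sum>a\<in>UNIV. m a *\<^sub>R x $ a)" for r and x :: "real^'a^'b"
    by (simp add: scaleR_sum_right mult.commute)
  then show ?thesis
    by (auto simp: subspace_def centered_def scaleR_add_right sum.distrib)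
qed

text \<open>The Lagrange multiplier rule on the mass sphere: criticality kills the tangential part
  of the gradient, and Euler's identity fixes the multiplier.\<close>

lemma normalized_CC_newton_force:
  fixes s :: "real^'d^('n::{finite,linorder})"
  assumes m: "\<And>a. m a > 0" and cc: "normalized_CC m s"
  shows "newton_force m s = - newton_U m s *\<^sub>R s"
proof -
  have s: "s \<in> centered m" "mass_norm m s = 1" "collision_free s"
    and crit: "(newton_U m has_derivative (\<lambda>h. 0)) (at s within {s' \<in> unit_configs m. collision_free s'})"
    using cc by (auto simp: normalized_CC_def unit_configs_def)
  have ss: "mass_inner m s s = 1" using s(2) by (simp add: mass_norm_def)
  have tangent: "mass_inner m (newton_force m s) h = 0"
    if h: "h \<in> centered m" "mass_inner m h h = 1" "mass_inner m s h = 0" for h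
  proof -
    \<comment> \<open>The great circle through \<open>s\<close> with initial velocity
      \<open>h\<close>.\<close>
    define f where "f \<theta> = cos \<theta> *\<^sub>R s + sin \<theta> *\<^sub>R h" for \<theta> :: real
    have f0: "f 0 = s" by (simp add: f_def)
    have unit: "f \<theta> \<in> unit_configs m" for \<theta>
    proof -
      have "mass_inner m (f \<theta>) (f \<theta>) = 1"
        using h ss mass_inner_commute[of m h s]
        by (simp add: f_def mass_inner_simps flip: power2_eq_square)
      moreover have "f \<theta> \<in> centered m"
        unfolding f_def using s h subspace_centered by (intro subspace_add subspace_scale) auto
      ultimately show ?thesis by (simp add: unit_configs_def mass_norm_def)
    qed
    have df: "(f has_derivative (\<lambda>x. x *\<^sub>R h)) (at 0 within X)" for X
      unfolding f_def by (auto intro!: derivative_eq_intros)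
    \<comment> \<open>Avoiding collisions is an open condition on the angle, so the derivative
      within the sphere becomes a two-sided derivative at angle 0.\<close>
    define X where "X = {\<theta>. collision_free (f \<theta>)}"
    have cont: "continuous_on UNIV (\<lambda>\<theta>. f \<theta> $ a)" for a
      unfolding f_def by (intro continuous_intros)
    have "X = (\<Inter>a. \<Inter>b\<in>{b. a \<noteq> b}. {\<theta>. f \<theta> $ a \<noteq> f \<theta> $ b})"
      by (auto simp: X_def collision_free_def)
    also have "open \<dots>"
      by (intro open_INT ballI finite open_Collect_neq cont)
    finally have "open X" .
    moreover have "0 \<in> X" using s(3) by (simp add: X_def f0)
    ultimately have at: "at 0 within X = at 0" by (intro at_within_open)
    have "(newton_U m has_derivative (\<lambda>h. 0)) (at (f 0) within f ` X)"
      unfolding f0 by (rule has_derivative_subset[OF crit]) (auto simp: X_def unit)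
    from has_derivative_in_compose[OF df this]
    have "((\<lambda>x. newton_U m (f x)) has_derivative (\<lambda>x. 0)) (at 0)" by (simp add: at)
    moreover have "((\<lambda>x. newton_U m (f x)) has_derivative (\<lambda>x. mass_inner m (newton_force m s) (x *\<^sub>R h))) (at 0)"
      using has_mass_gradient_newton_U[OF s(3), of m] unfolding has_mass_gradient_def
      by (intro has_derivative_compose[OF df]) (simp add: f0)
    ultimately have "(\<lambda>x. 0) = (\<lambda>x. mass_inner m (newton_force m s) (x *\<^sub>R h))"
      by (rule has_derivative_unique)
    from fun_cong[OF this, of 1] show ?thesis by simp
  qed
  \<comment> \<open>By Euler's identity \<open>w\<close> is tangent to the sphere at
    \<open>s\<close>; normalized, it is itself an admissible test direction.\<close>
  define w where "w = newton_force m s + newton_U m s *\<^sub>R s"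
  have "w = 0"
  proof (rule ccontr)
    assume w: "w \<noteq> 0"
    have ww: "mass_inner m w w > 0" by (rule mass_inner_self_pos[OF m w])
    define r where "r = sqrt (mass_inner m w w)"
    have r: "r > 0" "r * r = mass_inner m w w" using ww by (simp_all add: r_def)
    have sw: "mass_inner m s w = 0"
      by (simp add: w_def mass_inner_simps ss mass_inner_commute[of m s "newton_force m s"] newton_force_inner_self)
    have "mass_inner m (newton_force m s) (w /\<^sub>R r) = 0"
    proof (rule tangent)
      show "w /\<^sub>R r \<in> centered m"
        unfolding w_def using s subspace_centered newton_force_centered
        by (intro subspace_scale subspace_add) auto
      show "mass_inner m (w /\<^sub>R r) (w /\<^sub>R r) = 1" using r ww by (simp add: mass_inner_simps field_simps)
      show "mass_inner m s (w /\<^sub>R r) = 0" by (simp add: mass_inner_simps sw)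
    qed
    then have "mass_inner m (newton_force m s) w = 0" using r by (simp add: mass_inner_simps)
    moreover have "mass_inner m (newton_force m s + newton_U m s *\<^sub>R s) w
        = mass_inner m (newton_force m s) w + newton_U m s * mass_inner m s w"
      by (simp only: mass_inner_simps)
    ultimately have "mass_inner m w w = 0" unfolding sw w_def[symmetric] by simp
    with ww show False by simp
  qed
  then show ?thesis unfolding w_def scaleR_minus_left by (rule eq_neg_iff_add_eq_0[THEN iffD2])
qed


section \<open>Mass norm estimates and convergence of mutual distances\<close>

lemma has_real_derivative_mass_inner:
  assumes "(f has_vector_derivative f') (at t within X)" "(g has_vector_derivative g') (at t within X)"
  shows "((\<lambda>t. mass_inner m (f t) (g t)) has_real_derivative
          mass_inner m (f t) g' + mass_inner m f' (g t)) (at t within X)"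
proof -
  note nth = bounded_linear.has_vector_derivative[OF bounded_linear_vec_nth]
  have "((\<lambda>t. \<Sum>a\<in>UNIV. m a * (f t $ a \<bullet> g t $ a)) has_real_derivative
      (\<Sum>a\<in>UNIV. m a * (f t $ a \<bullet> g' $ a + f' $ a \<bullet> g t $ a))) (at t within X)"
    by (intro DERIV_sum DERIV_cmult has_real_derivative_inner nth assms)
  then show ?thesis by (simp add: mass_inner_def distrib_left sum.distrib)
qed

lemma mass_inner_nonneg: "(\<And>a. m a > 0) \<Longrightarrow> 0 \<le> mass_inner m x x"
  by (auto simp: mass_inner_def less_imp_le intro!: sum_nonneg)

lemma mass_inner_Cauchy_Schwarz:
  fixes x y :: "real^'d^'n"
  assumes m: "\<And>a. m a > 0"
  shows "(mass_inner m x y)\<^sup>2 \<le> mass_inner m x x * mass_inner m y y"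
proof -
  define S where "S z = (\<chi> a. sqrt (m a) *\<^sub>R z $ a)" for z :: "real^'d^'n"
  have "mass_inner m z w = S z \<bullet> S w" for z w
    unfolding mass_inner_def inner_vec_def[of "S z"]
  proof (intro sum.cong refl)
    show "m a * (z $ a \<bullet> w $ a) = S z $ a \<bullet> S w $ a" for a
      using m[of a] by (simp add: S_def flip: mult.assoc)
  qed
  then show ?thesis by (simp add: Cauchy_Schwarz_ineq)
qed

lemma component_le_mass_norm:
  fixes z :: "real^'d^'n"
  assumes m: "\<And>a. m a > 0"
  shows "norm (z $ a) \<le> 1 / sqrt (m a) * mass_norm m z"
proof -
  have "m a * (norm (z $ a))\<^sup>2 \<le> mass_inner m z z"
    unfolding mass_inner_def power2_norm_eq_inner
    using m by (intro member_le_sum) (auto simp: less_imp_le)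
  then have "sqrt (m a * (norm (z $ a))\<^sup>2) \<le> mass_norm m z" by (simp add: mass_norm_def)
  then show ?thesis using m[of a] by (simp add: real_sqrt_mult field_simps)
qed

text \<open>Each mutual distance is constant on the rotation orbit and Lipschitz in the mass norm,
  so it differs from its limit by at most a multiple of the distance to the orbit. No rotation has
  to be selected along the solution.\<close>

lemma limiting_shape_distances:
  fixes x :: "real \<Rightarrow> real^'d^'n" and s :: "real^'d^'n"
  assumes m: "\<And>a. m a > 0"
    and lim: "((\<lambda>t. mass_infdist m (x t) (rotation_orbit s)) \<longlongrightarrow> 0) F"
  shows "((\<lambda>t. norm (x t $ a - x t $ b)) \<longlongrightarrow> norm (s $ a - s $ b)) F"
proof -
  define K where "K = 1 / sqrt (m a) + 1 / sqrt (m b)"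
  have K: "K > 0" using m by (simp add: K_def add_pos_pos)
  have bound: "\<bar>norm (x t $ a - x t $ b) - norm (s $ a - s $ b)\<bar>
      \<le> K * mass_infdist m (x t) (rotation_orbit s)" for t
  proof -
    have "\<bar>norm (x t $ a - x t $ b) - norm (s $ a - s $ b)\<bar> / K
        \<le> mass_infdist m (x t) (rotation_orbit s)"
      unfolding mass_infdist_def
    proof (rule cINF_greatest)
      have "rotation_matrix (mat 1 :: real^'d^'d)" by (simp add: rotation_matrix_def orthogonal_matrix_id)
      then show "rotation_orbit s \<noteq> {}" by (auto simp: rotation_orbit_def)
    next
      fix y assume "y \<in> rotation_orbit s"
      then obtain g where g: "rotation_matrix g" and y: "y = (\<chi> a. g *v s $ a)"
        by (auto simp: rotation_orbit_def)
      have "orthogonal_transformation ((*v) g)"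
        using g by (simp add: rotation_matrix_def orthogonal_transformation_matrix)
      then have "norm (y $ a - y $ b) = norm (s $ a - s $ b)"
        unfolding y by (simp add: orthogonal_transformation_norm flip: matrix_vector_mult_diff_distrib)
      then have "\<bar>norm (x t $ a - x t $ b) - norm (s $ a - s $ b)\<bar>
          \<le> norm ((x t $ a - x t $ b) - (y $ a - y $ b))"
        using norm_triangle_ineq3 by metis
      also have "\<dots> = norm ((x t - y) $ a - (x t - y) $ b)" by (simp add: algebra_simps)
      also have "\<dots> \<le> norm ((x t - y) $ a) + norm ((x t - y) $ b)" by (rule norm_triangle_ineq4)
      also have "\<dots> \<le> K * mass_norm m (x t - y)"
        using component_le_mass_norm[of m "x t - y", OF m] unfolding K_def distrib_right
        by (intro add_mono) auto
      finally show "\<bar>norm (x t $ a - x t $ b) - norm (s $ a - s $ b)\<bar> / K \<le> mass_norm m (x t - y)"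
        using K by (simp add: field_simps)
    qed
    then show ?thesis using K by (simp add: field_simps)
  qed
  have "((\<lambda>t. norm (x t $ a - x t $ b) - norm (s $ a - s $ b)) \<longlongrightarrow> 0) F"
  proof (rule Lim_null_comparison)
    show "\<forall>\<^sub>F t in F. norm (norm (x t $ a - x t $ b) - norm (s $ a - s $ b))
        \<le> K * mass_infdist m (x t) (rotation_orbit s)"
      using bound by simp
    show "((\<lambda>t. K * mass_infdist m (x t) (rotation_orbit s)) \<longlongrightarrow> 0) F"
      using tendsto_mult_right_zero[OF lim] by simp
  qed
  then show ?thesis by (simp add: LIM_zero_iff)
qed

lemma limiting_shape_kernel:
  fixes x :: "real \<Rightarrow> real^'d^('n::{finite,linorder})" and s :: "real^'d^('n::{finite,linorder})"
  assumes m: "\<And>a. m a > 0" and s: "collision_free s"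
    and lim: "((\<lambda>t. mass_infdist m (x t) (rotation_orbit s)) \<longlongrightarrow> 0) F"
  shows "((\<lambda>t. kernel (x t) a b) \<longlongrightarrow> kernel s a b) F"
    and "((\<lambda>t. newton_U m (x t)) \<longlongrightarrow> newton_U m s) F"
proof -
  note dist = limiting_shape_distances[of m, OF m lim]
  have nz: "norm (s $ b - s $ a) \<noteq> 0" if "a \<noteq> b" for a b
    using s that by (auto simp: collision_free_def)
  show "((\<lambda>t. kernel (x t) a b) \<longlongrightarrow> kernel s a b) F"
  proof (cases "a = b")
    case False
    then show ?thesis unfolding kernel_def using nz
      by (intro tendsto_divide tendsto_const tendsto_power dist power_not_zero) auto
  qed (simp add: kernel_def)
  have pair: "((\<lambda>t. m a * m b / norm (x t $ a - x t $ b)) \<longlongrightarrow> m a * m b / norm (s $ a - s $ b)) F" for a b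
  proof (cases "a = b")
    case False
    then show ?thesis using nz[of b a] by (intro tendsto_divide tendsto_const dist) auto
  qed simp
  show "((\<lambda>t. newton_U m (x t)) \<longlongrightarrow> newton_U m s) F"
    unfolding newton_U_double by (intro tendsto_divide tendsto_const tendsto_sum pair) auto
qed

section \<open>Asymptotics of total collapse\<close>

text \<open>About the shape only the limit of the normalized potential is assumed; the size and
  radial velocity of the collapse are determined from it.\<close>

locale total_collapse =
  fixes m :: "'n::{finite,linorder} \<Rightarrow> real"
    and q q' :: "real \<Rightarrow> real^'d^('n::{finite,linorder})"
    and t0 T \<Lambda> :: real
  assumes m: "\<And>a. m a > 0"
    and t0: "t0 < T"
    and centered: "\<And>t. t \<in> {t0..<T} \<Longrightarrow> q t \<in> centered m"
    and coll_free: "\<And>t. t \<in> {t0..<T} \<Longrightarrow> collision_free (q t)"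
    and nonzero: "\<And>t. t \<in> {t0..<T} \<Longrightarrow> q t \<noteq> 0"
    and dq: "\<And>t. t \<in> {t0..<T} \<Longrightarrow> (q has_vector_derivative q' t) (at t within {t0..<T})"
    and dq': "\<And>t. t \<in> {t0..<T} \<Longrightarrow>
      (q' has_vector_derivative newton_force m (q t)) (at t within {t0..<T})"
    and collapse: "(q \<longlongrightarrow> 0) (at_left T)"
    and \<Lambda>: "0 < \<Lambda>"
    and potential: "((\<lambda>t. newton_U m (q t /\<^sub>R mass_norm m (q t))) \<longlongrightarrow> \<Lambda>) (at_left T)"
begin

text \<open>McGehee's blow-up variables: \<open>R\<close> is the factor \<open>r powr (3/2)\<close>
  between physical and rescaled time, \<open>v\<close> is \<open>sqrt r\<close> times the derivative
  of \<open>r\<close>, \<open>u\<close> is the potential of the normalized shape, and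
  \<open>h\<close> is the energy. The limit of \<open>v\<close> will be -\<nu>.\<close>

definition r where "r t = mass_norm m (q t)"
definition \<rho> where "\<rho> t = sqrt (r t)"
definition R where "R t = r t * \<rho> t"
definition v where "v t = mass_inner m (q t) (q' t) / \<rho> t"
definition h where "h = mass_inner m (q' t0) (q' t0) / 2 - newton_U m (q t0)"
definition u where "u t = newton_U m (q t /\<^sub>R r t)"
definition \<nu> where "\<nu> = sqrt (2 * \<Lambda>)"

lemma \<nu>: "\<nu> > 0" "\<nu>\<^sup>2 = 2 * \<Lambda>"
  using \<Lambda> by (simp_all add: \<nu>_def)

lemma r_pos: "t \<in> {t0..<T} \<Longrightarrow> 0 < r t"
  using mass_inner_self_pos[of m "q t", OF m nonzero] by (simp add: r_def mass_norm_def)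

lemma r_sq: "(r t)\<^sup>2 = mass_inner m (q t) (q t)"
  using mass_inner_nonneg[of m "q t", OF m] by (simp add: r_def mass_norm_def)

lemma \<rho>_pos: "t \<in> {t0..<T} \<Longrightarrow> 0 < \<rho> t"
  and \<rho>_sq: "t \<in> {t0..<T} \<Longrightarrow> \<rho> t * \<rho> t = r t"
  and R_pos: "t \<in> {t0..<T} \<Longrightarrow> 0 < R t"
  using r_pos[of t] by (simp_all add: \<rho>_def R_def)

lemma r_deriv:
  assumes t: "t \<in> {t0..<T}"
  shows "(r has_real_derivative v t / \<rho> t) (at t within {t0..<T})"
proof -
  have pos: "0 < mass_inner m (q t) (q t)" by (rule mass_inner_self_pos[OF m nonzero[OF t]])
  have "((\<lambda>t. sqrt (mass_inner m (q t) (q t))) has_real_derivative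
      (2 * mass_inner m (q t) (q' t)) * (inverse (sqrt (mass_inner m (q t) (q t))) / 2))
      (at t within {t0..<T})"
  proof -
    have 1: "((\<lambda>t. mass_inner m (q t) (q t)) has_real_derivative 2 * mass_inner m (q t) (q' t)) (at t within {t0..<T})"
      using has_real_derivative_mass_inner[OF dq[OF t] dq[OF t], of m]
      unfolding mass_inner_commute[of m "q' t" "q t"] by (simp only: mult_2)
    have 2: "(sqrt has_real_derivative inverse (sqrt (mass_inner m (q t) (q t))) / 2) (at (mass_inner m (q t) (q t)))"
      by (rule DERIV_real_sqrt[OF pos])
    from DERIV_chain2[of sqrt _ "\<lambda>t. mass_inner m (q t) (q t)", OF 2 1]
    show ?thesis by (simp only: mult.commute)
  qed
  moreover have "(2 * mass_inner m (q t) (q' t)) * (inverse (sqrt (mass_inner m (q t) (q t))) / 2)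
      = v t / \<rho> t"
  proof -
    have "sqrt (mass_inner m (q t) (q t)) = \<rho> t * \<rho> t"
      using \<rho>_sq[OF t] by (simp add: r_def mass_norm_def)
    then show ?thesis using \<rho>_pos[OF t] by (simp add: v_def divide_simps)
  qed
  ultimately show ?thesis by (simp add: r_def[abs_def] mass_norm_def)
qed

lemma \<rho>_deriv:
  assumes t: "t \<in> {t0..<T}"
  shows "(\<rho> has_real_derivative v t / (2 * r t)) (at t within {t0..<T})"
proof -
  have "((\<lambda>t. sqrt (r t)) has_real_derivative inverse (sqrt (r t)) / 2 * (v t / \<rho> t)) (at t within {t0..<T})"
    by (rule DERIV_chain2[where f = sqrt and g = r, OF DERIV_real_sqrt[OF r_pos[OF t]] r_deriv[OF t]])
  moreover have "inverse (sqrt (r t)) / 2 * (v t / \<rho> t) = v t / (2 * r t)"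
    using \<rho>_sq[OF t] unfolding \<rho>_def[symmetric] by (simp add: divide_simps mult_ac)
  ultimately show ?thesis by (simp add: \<rho>_def[abs_def])
qed

lemma R_deriv:
  assumes t: "t \<in> {t0..<T}"
  shows "(R has_real_derivative 3 / 2 * v t) (at t within {t0..<T})"
  unfolding R_def[abs_def]
  by (rule DERIV_cong[OF DERIV_mult[OF r_deriv[OF t] \<rho>_deriv[OF t]]])
    (use r_pos[OF t] \<rho>_pos[OF t] in simp)

lemma u_eq: "t \<in> {t0..<T} \<Longrightarrow> u t = r t * newton_U m (q t)"
  using newton_U_scale[OF r_pos] by (simp add: u_def)

text \<open>Conservation of energy multiplied by \<open>r\<close>, which makes both sides converge
  at the collapse although speed and potential blow up.\<close>

lemma energy:
  assumes t: "t \<in> {t0..<T}"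
  shows "r t * mass_inner m (q' t) (q' t) = 2 * u t + 2 * h * r t"
proof -
  define e where "e t = mass_inner m (q' t) (q' t) / 2 - newton_U m (q t)" for t
  have "(e has_real_derivative 0) (at t within {t0..<T})" if t: "t \<in> {t0..<T}" for t
  proof -
    have "((\<lambda>t. newton_U m (q t)) has_vector_derivative mass_inner m (newton_force m (q t)) (q' t))
        (at t within {t0..<T})"
    proof -
      have "(newton_U m has_derivative mass_inner m (newton_force m (q t))) (at (q t))"
        using has_mass_gradient_newton_U[OF coll_free[OF t], of m] by (simp add: has_mass_gradient_def)
      from has_derivative_compose[OF dq[OF t, unfolded has_vector_derivative_def] this]
      show ?thesis by (simp add: has_vector_derivative_def mass_inner_simps)
    qed
    note U = this[folded has_real_derivative_iff_has_vector_derivative]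
    show ?thesis
      unfolding e_def
      by (rule DERIV_cong[OF DERIV_diff[OF DERIV_cdivide[OF
              has_real_derivative_mass_inner[OF dq'[OF t] dq'[OF t]]] U]])
        (simp add: mass_inner_commute[of m "q' t" "newton_force m (q t)"])
  qed
  then obtain c where "\<forall>t\<in>{t0..<T}. e t = c"
    using has_field_derivative_zero_constant[of "{t0..<T}" e] by auto
  then have "e t = e t0" using t t0 by simp
  then have "mass_inner m (q' t) (q' t) = 2 * newton_U m (q t) + 2 * h"
    by (simp add: e_def h_def field_simps)
  then show ?thesis using u_eq[OF t] by (simp add: algebra_simps)
qed

text \<open>Cauchy-Schwarz bounds the radial part of the kinetic energy by the whole.\<close>

lemma v_sq_le:
  assumes t: "t \<in> {t0..<T}"
  shows "(v t)\<^sup>2 \<le> 2 * u t + 2 * h * r t"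
proof -
  have "(v t)\<^sup>2 = (mass_inner m (q t) (q' t))\<^sup>2 / r t"
    using \<rho>_sq[OF t] by (simp add: v_def power_divide power2_eq_square)
  also have "\<dots> \<le> (r t)\<^sup>2 * mass_inner m (q' t) (q' t) / r t"
    unfolding r_sq using r_pos[OF t] by (intro divide_right_mono mass_inner_Cauchy_Schwarz m) simp
  also have "\<dots> = r t * mass_inner m (q' t) (q' t)" using r_pos[OF t] by (simp add: power2_eq_square)
  finally show ?thesis by (simp add: energy[OF t])
qed

definition v' where "v' t = (2 * h * r t + u t - (v t)\<^sup>2 / 2) / R t"

text \<open>The Lagrange-Jacobi identity in blow-up variables, with the kinetic energy eliminated by
  energy conservation.\<close>

lemma v_deriv:
  assumes t: "t \<in> {t0..<T}"
  shows "(v has_real_derivative v' t) (at t within {t0..<T})"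
proof -
  have nz: "\<rho> t \<noteq> 0" "r t \<noteq> 0" using \<rho>_pos[OF t] r_pos[OF t] by auto
  have q': "mass_inner m (q' t) (q' t) = (2 * u t + 2 * h * r t) / r t"
    using energy[OF t] nz by (simp add: field_simps)
  have U: "newton_U m (q t) = u t / r t" using u_eq[OF t] nz by simp
  have vq: "mass_inner m (q t) (q' t) = v t * \<rho> t" using nz by (simp add: v_def)
  have F: "mass_inner m (q t) (newton_force m (q t)) = - newton_U m (q t)"
    by (subst mass_inner_commute) (rule newton_force_inner_self)
  have r: "r t = \<rho> t * \<rho> t" using \<rho>_sq[OF t] by simp
  show ?thesis
    unfolding v_def[abs_def]
    by (rule DERIV_cong[OF DERIV_divide[OF has_real_derivative_mass_inner[OF dq[OF t] dq'[OF t]]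
            \<rho>_deriv[OF t] nz(1)]])
      (unfold F vq q' U v'_def R_def, use nz in \<open>simp add: r field_simps power2_eq_square\<close>)
qed

end


lemma eventually_at_left_interval:
  fixes t0 T :: real
  assumes "t0 < T" "eventually P (at_left T)"
  obtains t1 where "t1 \<in> {t0..<T}" "\<And>t. t \<in> {t1..<T} \<Longrightarrow> P t"
proof -
  obtain b where b: "b < T" "\<And>y. b < y \<Longrightarrow> y < T \<Longrightarrow> P y"
    using assms(2) unfolding eventually_at_left_field by blast
  show thesis using assms(1) b by (intro that[of "max t0 ((b + T) / 2)"]) auto
qed

context total_collapse
begin

lemma deriv_subset:
  assumes "(f has_real_derivative d) (at t within {t0..<T})" "t1 \<in> {t0..<T}"
  shows "(f has_real_derivative d) (at t within {t1..<T})"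
  by (rule DERIV_subset[OF assms(1)]) (use assms(2) in auto)

lemma r_tendsto: "(r \<longlongrightarrow> 0) (at_left T)"
proof -
  have "((\<lambda>t. sqrt (\<Sum>a\<in>UNIV. m a * (q t $ a \<bullet> q t $ a))) \<longlongrightarrow> sqrt (\<Sum>a\<in>UNIV. m a * (0 $ a \<bullet> (0 :: real^'d^('n::{finite,linorder})) $ a))) (at_left T)"
    by (intro tendsto_intros tendsto_vec_nth collapse)
  then show ?thesis by (simp add: r_def[abs_def] mass_norm_def mass_inner_def)
qed

lemma R_tendsto: "(R \<longlongrightarrow> 0) (at_left T)"
proof -
  have "((\<lambda>t. r t * sqrt (r t)) \<longlongrightarrow> 0 * sqrt 0) (at_left T)"
    by (intro tendsto_intros r_tendsto)
  then show ?thesis by (simp add: R_def[abs_def] \<rho>_def)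
qed

lemma u_tendsto: "(u \<longlongrightarrow> \<Lambda>) (at_left T)"
  using potential by (simp add: u_def[abs_def] r_def)

text \<open>\<open>R\<close> tends to 0 at \<open>T\<close> and has derivative
  \<open>3 / 2 * v\<close>, so integrating back from \<open>T\<close> turns a lower bound on
  \<open>v\<close> into an upper bound on \<open>R\<close>.\<close>

lemma R_le:
  assumes t1: "t1 \<in> {t0..<T}" and v: "\<And>t. t \<in> {t1..<T} \<Longrightarrow> - V \<le> v t" and t: "t \<in> {t1..<T}"
  shows "R t \<le> 3 / 2 * V * (T - t)"
proof (rule tendsto_lowerbound)
  have "((\<lambda>s. R s + 3 / 2 * V * (s - t)) \<longlongrightarrow> 0 + 3 / 2 * V * (T - t)) (at_left T)"
    by (intro tendsto_intros R_tendsto)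
  then show "((\<lambda>s. R s + 3 / 2 * V * (s - t)) \<longlongrightarrow> 3 / 2 * V * (T - t)) (at_left T)" by simp
  have "R t \<le> R s + 3 / 2 * V * (s - t)" if s: "t < s" "s < T" for s
  proof -
    have "R t + 3 / 2 * V * (t - t) \<le> R s + 3 / 2 * V * (s - t)"
    proof (rule nondecreasing_within[where f = "\<lambda>s. R s + 3 / 2 * V * (s - t)"
            and f' = "\<lambda>s. 3 / 2 * v s + 3 / 2 * V"])
      fix x assume x: "x \<in> {t..s}"
      have "(R has_real_derivative 3 / 2 * v x) (at x within {t..s})"
        by (rule DERIV_subset[OF R_deriv]) (use x s t t1 in auto)
      then show "((\<lambda>s. R s + 3 / 2 * V * (s - t)) has_real_derivative 3 / 2 * v x + 3 / 2 * V)
          (at x within {t..s})"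
        by (auto intro!: derivative_eq_intros)
      show "0 \<le> 3 / 2 * v x + 3 / 2 * V" using v[of x] x s t by auto
    qed (use s in simp)
    then show ?thesis by simp
  qed
  then show "\<forall>\<^sub>F s in at_left T. R t \<le> R s + 3 / 2 * V * (s - t)"
    using t unfolding eventually_at_left_field by auto
qed simp

lemma v_continuous: "S \<subseteq> {t0..<T} \<Longrightarrow> continuous_on S v"
  and R_continuous: "S \<subseteq> {t0..<T} \<Longrightarrow> continuous_on S R"
proof -
  have "continuous_on {t0..<T} v" "continuous_on {t0..<T} R"
    using DERIV_continuous[OF v_deriv] DERIV_continuous[OF R_deriv]
    by (simp_all add: continuous_on_eq_continuous_within)
  then show "S \<subseteq> {t0..<T} \<Longrightarrow> continuous_on S v" "S \<subseteq> {t0..<T} \<Longrightarrow> continuous_on S R"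
    by (auto intro: continuous_on_subset)
qed

lemma energy_tendsto: "((\<lambda>t. 2 * u t + 2 * h * r t) \<longlongrightarrow> \<nu>\<^sup>2) (at_left T)"
proof -
  have "((\<lambda>t. 2 * u t + 2 * h * r t) \<longlongrightarrow> 2 * \<Lambda> + 2 * h * 0) (at_left T)"
    by (intro tendsto_intros u_tendsto r_tendsto)
  then show ?thesis by (simp add: \<nu>)
qed

lemma abs_v_eventually_less:
  assumes "B > \<nu>"
  shows "\<forall>\<^sub>F t in at_left T. \<bar>v t\<bar> < B"
proof -
  have "\<nu>\<^sup>2 < B\<^sup>2" using assms \<nu>(1) by (intro power_strict_mono) auto
  then obtain t1 where t1: "t1 \<in> {t0..<T}" "\<And>t. t \<in> {t1..<T} \<Longrightarrow> 2 * u t + 2 * h * r t < B\<^sup>2"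
    using eventually_at_left_interval[OF t0 order_tendstoD(2)[OF energy_tendsto]] by metis
  have "\<bar>v t\<bar> < B" if t: "t \<in> {t1..<T}" for t
  proof -
    have tI: "t \<in> {t0..<T}" using t t1(1) by auto
    have *: "(v t)\<^sup>2 < B\<^sup>2" by (rule le_less_trans[OF v_sq_le[OF tI] t1(2)[OF t]])
    have B: "0 \<le> B" using assms \<nu>(1) by linarith
    have "\<bar>v t\<bar>\<^sup>2 < B\<^sup>2" using * by simp
    then show ?thesis using B by (rule power2_less_imp_less)
  qed
  then show ?thesis using t1(1) unfolding eventually_at_left_field by (intro exI[of _ t1]) auto
qed

text \<open>If \<open>v\<close> stayed away from \<open>-\<nu>\<close>, the equation \<open>R v' \<approx> (\<nu>\<^sup>2 - v\<^sup>2) / 2\<close> together with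
  \<open>R = O(T - t)\<close> would force \<open>v\<close> to grow logarithmically.\<close>

lemma v_eventually_upper:
  assumes \<beta>: "0 < \<beta>" "\<beta> < \<nu>"
  shows "\<forall>\<^sub>F t in at_left T. v t < - \<beta>"
proof -
  \<comment> \<open>Since twice \<open>2 * h * r + u\<close> tends to \<open>\<nu>\<^sup>2\<close>,
    it eventually exceeds \<open>\<alpha>\<^sup>2\<close>. The gap above
    \<open>\<beta>\<^sup>2\<close> is the uniform growth rate of \<open>v\<close> while its modulus
    is at most \<beta>.\<close>
  define \<alpha> where "\<alpha> = (\<beta> + \<nu>) / 2"
  have \<alpha>: "\<beta> < \<alpha>" "\<alpha> < \<nu>" using \<beta> by (auto simp: \<alpha>_def)
  have sq: "\<alpha>\<^sup>2 < \<nu>\<^sup>2" "\<beta>\<^sup>2 < \<alpha>\<^sup>2" using \<alpha> \<beta> by (auto intro!: power_strict_mono)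
  have "((\<lambda>t. 2 * (2 * h * r t + u t)) \<longlongrightarrow> 2 * (2 * h * 0 + \<Lambda>)) (at_left T)"
    by (intro tendsto_intros u_tendsto r_tendsto)
  then have "\<forall>\<^sub>F t in at_left T. \<alpha>\<^sup>2 < 2 * (2 * h * r t + u t)"
    using sq(1) by (intro order_tendstoD(1)) (auto simp: \<nu>)
  moreover have "\<forall>\<^sub>F t in at_left T. \<bar>v t\<bar> < \<nu> + 1" by (rule abs_v_eventually_less) simp
  ultimately have both: "\<forall>\<^sub>F t in at_left T. \<alpha>\<^sup>2 < 2 * (2 * h * r t + u t) \<and> \<bar>v t\<bar> < \<nu> + 1"
    by (rule eventually_conj)
  obtain t1 where t1: "t1 \<in> {t0..<T}"
    and ev: "\<And>t. t \<in> {t1..<T} \<Longrightarrow> \<alpha>\<^sup>2 < 2 * (2 * h * r t + u t) \<and> \<bar>v t\<bar> < \<nu> + 1"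
    by (rule eventually_at_left_interval[OF t0 both]) blast
  have v'_ge: "(\<alpha>\<^sup>2 - (v t)\<^sup>2) / 2 / R t \<le> v' t" if "t \<in> {t1..<T}" for t
    unfolding v'_def using ev[OF that] R_pos[of t] that t1 by (intro divide_right_mono) auto
  \<comment> \<open>Once nonnegative, \<open>v\<close> would stay so, and \<open>R_le\<close> with
    bound 0 would give a nonpositive \<open>R\<close>.\<close>
  have negative: "v t < 0" if t: "t \<in> {t1..<T}" for t
  proof (rule ccontr)
    assume "\<not> v t < 0"
    then have vt: "0 \<le> v t" by simp
    have tI: "t \<in> {t0..<T}" using t t1 by auto
    have "- 0 \<le> v s" if s: "s \<in> {t..<T}" for s
    proof -
      have "\<exists>E>0. E * v t \<le> v s"
      proof (rule gronwall_lower[where f = v and f' = v' and g = "\<lambda>s. - v s / 2 / R s"])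
        show "t \<le> s" using s by simp
        show "(v has_real_derivative v' x) (at x within {t..s})" if x: "x \<in> {t..s}" for x
          by (rule DERIV_subset[OF v_deriv]) (use x s tI in auto)
        have "{t..s} \<subseteq> {t0..<T}" using s tI by auto
        then show "continuous_on {t..s} (\<lambda>s. - v s / 2 / R s)"
          using R_pos by (intro continuous_intros v_continuous R_continuous) force+
        show "- v x / 2 / R x * v x \<le> v' x" if x: "x \<in> {t..s}" for x
        proof -
          have "- v x / 2 / R x * v x = (0 - (v x)\<^sup>2) / 2 / R x" by (simp add: power2_eq_square)
          also have "\<dots> \<le> (\<alpha>\<^sup>2 - (v x)\<^sup>2) / 2 / R x"
            using R_pos[of x] x s tI by (intro divide_right_mono) auto
          also have "\<dots> \<le> v' x" by (rule v'_ge) (use x s t in auto)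
          finally show ?thesis .
        qed
      qed
      then obtain E where "E > 0" "E * v t \<le> v s" by blast
      moreover have "0 \<le> E * v t" using \<open>E > 0\<close> vt by simp
      ultimately show ?thesis by simp
    qed
    from R_le[OF tI this, of t] R_pos[OF tI] t show False by simp
  qed
  have "v t < - \<beta>" if t: "t \<in> {t1..<T}" for t
  proof (rule ccontr)
    assume "\<not> v t < - \<beta>"
    then have vt: "v t \<ge> - \<beta>" by simp
    have tI: "t \<in> {t0..<T}" using t t1 by auto
    \<comment> \<open>The level -\<beta> is a barrier that \<open>v\<close> can cross only
      upwards.\<close>
    have above: "- \<beta> \<le> v s" if s: "s \<in> {t..<T}" for s
    proof -
      have "\<exists>E>0. E * (v t + \<beta>) \<le> v s + \<beta>"
      proof (rule gronwall_lower[where f = "\<lambda>s. v s + \<beta>" and f' = v'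
            and g = "\<lambda>s. (\<beta> - v s) / 2 / R s"])
        show "t \<le> s" using s by simp
        show "((\<lambda>s. v s + \<beta>) has_real_derivative v' x) (at x within {t..s})" if x: "x \<in> {t..s}" for x
        proof -
          have "(v has_real_derivative v' x) (at x within {t..s})"
            by (rule DERIV_subset[OF v_deriv]) (use x s tI in auto)
          then show ?thesis by (auto intro!: derivative_eq_intros)
        qed
        have "{t..s} \<subseteq> {t0..<T}" using s tI by auto
        then show "continuous_on {t..s} (\<lambda>s. (\<beta> - v s) / 2 / R s)"
          using R_pos by (intro continuous_intros v_continuous R_continuous) force+
        show "(\<beta> - v x) / 2 / R x * (v x + \<beta>) \<le> v' x" if x: "x \<in> {t..s}" for x
        proof -
          have "(\<beta> - v x) / 2 / R x * (v x + \<beta>) = (\<beta>\<^sup>2 - (v x)\<^sup>2) / 2 / R x"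
            by (simp add: power2_eq_square algebra_simps)
          also have "\<dots> \<le> (\<alpha>\<^sup>2 - (v x)\<^sup>2) / 2 / R x"
            using sq R_pos[of x] x s tI by (intro divide_right_mono) auto
          also have "\<dots> \<le> v' x" by (rule v'_ge) (use x s t in auto)
          finally show ?thesis .
        qed
      qed
      then obtain E where "E > 0" "E * (v t + \<beta>) \<le> v s + \<beta>" by blast
      moreover have "0 \<le> E * (v t + \<beta>)" using \<open>E > 0\<close> vt by simp
      ultimately show ?thesis by linarith
    qed
    \<comment> \<open>Now \<open>v\<close> stays between -\<beta> and 0, so
      \<open>R = O(T - t)\<close> and \<open>v\<close> would grow logarithmically.\<close>
    show False
    proof (rule log_growth_unbounded[of t T "(\<alpha>\<^sup>2 - \<beta>\<^sup>2) / 2 / (3 / 2 * \<beta>)" v v' "\<nu> + 1"])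
      show "t < T" using t by simp
      show "0 < (\<alpha>\<^sup>2 - \<beta>\<^sup>2) / 2 / (3 / 2 * \<beta>)" using sq \<beta> by simp
      fix s assume s: "s \<in> {t..<T}"
      then have sI: "s \<in> {t0..<T}" "s \<in> {t1..<T}" using t tI by auto
      show "(v has_real_derivative v' s) (at s within {t..<T})"
        by (rule deriv_subset[OF v_deriv[OF sI(1)] tI])
      show "v s \<le> \<nu> + 1" using ev[OF sI(2)] by auto
      have "(\<alpha>\<^sup>2 - (v s)\<^sup>2) / 2 / R s \<le> v' s" by (rule v'_ge[OF sI(2)])
      show "(\<alpha>\<^sup>2 - \<beta>\<^sup>2) / 2 / (3 / 2 * \<beta>) / (T - s) \<le> v' s"
      proof -
        have True: "v s \<le> \<beta>" using negative[OF sI(2)] \<beta> by linarith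
        have Rs: "0 < R s" "R s \<le> 3 / 2 * \<beta> * (T - s)"
          using R_pos[OF sI(1)] R_le[OF tI above s] by auto
        have "(v s)\<^sup>2 \<le> \<beta>\<^sup>2" using True above[OF s] by (simp add: abs_le_square_iff[symmetric])
        have "(\<alpha>\<^sup>2 - \<beta>\<^sup>2) / 2 / (3 / 2 * \<beta>) / (T - s) = (\<alpha>\<^sup>2 - \<beta>\<^sup>2) / 2 / (3 / 2 * \<beta> * (T - s))"
          by simp
        also have "\<dots> \<le> (\<alpha>\<^sup>2 - \<beta>\<^sup>2) / 2 / R s"
          using Rs sq by (intro divide_left_mono) auto
        also have "\<dots> \<le> (\<alpha>\<^sup>2 - (v s)\<^sup>2) / 2 / R s"
          using Rs \<open>(v s)\<^sup>2 \<le> \<beta>\<^sup>2\<close> by (intro divide_right_mono) auto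
        also have "\<dots> \<le> v' s" by (rule v'_ge[OF sI(2)])
        finally show ?thesis .
      qed
    qed
  qed
  then show ?thesis using t1(1) unfolding eventually_at_left_field by (intro exI[of _ t1]) auto
qed

lemma v_tendsto: "(v \<longlongrightarrow> - \<nu>) (at_left T)"
proof (rule order_tendstoI)
  fix a assume "a < - \<nu>"
  then have "\<forall>\<^sub>F t in at_left T. \<bar>v t\<bar> < - a" by (intro abs_v_eventually_less) simp
  then show "\<forall>\<^sub>F t in at_left T. a < v t" by eventually_elim auto
next
  fix a assume a: "- \<nu> < a"
  have "\<forall>\<^sub>F t in at_left T. v t < - max (- a) (\<nu> / 2)"
    using a \<nu>(1) by (intro v_eventually_upper) auto
  then show "\<forall>\<^sub>F t in at_left T. v t < a" by eventually_elim auto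
qed

end


section \<open>Rescaled coordinates of a collapsing solution\<close>

lemma pair_op_scale_kernel: "pair_op m (\<lambda>a b. s * k a b) z = s *\<^sub>R pair_op m k z"
  by (simp add: pair_op_def vec_eq_iff sum_distrib_left mult_ac)

context total_collapse
begin

text \<open>
  With the time \<open>d\<tau> = dt / R\<close>, \<open>R = r powr (3/2)\<close>, one has \<open>dS/d\<tau> = p - v S\<close>. As \<open>v \<longlonglongrightarrow> -\<nu>\<close>, the
  combination \<open>w = p + \<nu> S\<close> is \<open>dS/d\<tau>\<close> up to \<open>o(S)\<close>, and it avoids differentiating \<open>v\<close>.
\<close>

definition z where "z e t = weighted m e (q t)"
definition z' where "z' e t = weighted m e (q' t)"
definition S where "S e t = (1 / r t) *\<^sub>R z e t"
definition p where "p e t = \<rho> t *\<^sub>R z' e t"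
definition w where "w e t = p e t + \<nu> *\<^sub>R S e t"

lemma z_deriv: "t \<in> {t0..<T} \<Longrightarrow> (z e has_vector_derivative z' e t) (at t within {t0..<T})"
  unfolding z_def[abs_def] z'_def by (rule bounded_linear.has_vector_derivative[OF bounded_linear_weighted dq])

lemma z'_deriv:
  "t \<in> {t0..<T} \<Longrightarrow>
    (z' e has_vector_derivative pair_op m (kernel (q t)) (z e t)) (at t within {t0..<T})"
  unfolding z_def z'_def[abs_def] weighted_newton_force[of m e, OF m, symmetric]
  by (rule bounded_linear.has_vector_derivative[OF bounded_linear_weighted dq'])

definition S' where "S' e t = (1 / R t) *\<^sub>R (p e t - v t *\<^sub>R S e t)"
definition p' where
  "p' e t = (1 / R t) *\<^sub>R ((v t / 2) *\<^sub>R p e t + pair_op m (kernel (q t /\<^sub>R r t)) (S e t))"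

lemma S_deriv:
  assumes t: "t \<in> {t0..<T}"
  shows "(S e has_vector_derivative S' e t) (at t within {t0..<T})"
proof -
  have nz: "r t \<noteq> 0" "\<rho> t \<noteq> 0" using r_pos[OF t] \<rho>_pos[OF t] by auto
  have "((\<lambda>t. 1 / r t) has_real_derivative - (v t / \<rho> t) / (r t * r t)) (at t within {t0..<T})"
    by (rule DERIV_cong[OF DERIV_divide[OF DERIV_const r_deriv[OF t] nz(1)]]) simp
  from has_vector_derivative_scaleR[OF this z_deriv[OF t, of e]]
  have "(S e has_vector_derivative (1 / r t) *\<^sub>R z' e t + (- (v t / \<rho> t) / (r t * r t)) *\<^sub>R z e t)
      (at t within {t0..<T})"
    by (simp add: S_def[abs_def])
  moreover have "(1 / r t) *\<^sub>R z' e t + (- (v t / \<rho> t) / (r t * r t)) *\<^sub>R z e t = S' e t"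
    using nz by (simp add: S'_def p_def S_def R_def scaleR_diff_right mult_ac)
  ultimately show ?thesis by simp
qed

lemma p_deriv:
  assumes t: "t \<in> {t0..<T}"
  shows "(p e has_vector_derivative p' e t) (at t within {t0..<T})"
proof -
  have nz: "r t \<noteq> 0" "\<rho> t \<noteq> 0" using r_pos[OF t] \<rho>_pos[OF t] by auto
  have "kernel (q t /\<^sub>R r t) = (\<lambda>a b. r t ^ 3 * kernel (q t) a b)"
    using kernel_scale[OF r_pos[OF t]] by (intro ext)
  then have "pair_op m (kernel (q t /\<^sub>R r t)) (S e t)
      = (r t ^ 3 * (1 / r t)) *\<^sub>R pair_op m (kernel (q t)) (z e t)"
    by (simp only: pair_op_scale_kernel S_def linear_scale[OF linear_pair_op] scaleR_scaleR)
  moreover have "1 / R t * (r t ^ 3 * (1 / r t)) = \<rho> t"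
    using nz \<rho>_sq[OF t] by (simp add: R_def field_simps power3_eq_cube)
  moreover have "1 / R t * (v t / 2 * \<rho> t) = v t / (2 * r t)"
    using nz by (simp add: R_def)
  ultimately have "p' e t = \<rho> t *\<^sub>R pair_op m (kernel (q t)) (z e t) + (v t / (2 * r t)) *\<^sub>R z' e t"
    by (simp only: p'_def p_def scaleR_add_right scaleR_scaleR add.commute)
  then show ?thesis
    using has_vector_derivative_scaleR[OF \<rho>_deriv[OF t] z'_deriv[OF t, of e]]
    by (simp only: p_def[abs_def])
qed

lemma w_deriv:
  assumes t: "t \<in> {t0..<T}"
  shows "(w e has_vector_derivative p' e t + \<nu> *\<^sub>R S' e t) (at t within {t0..<T})"
proof -
  have "((\<lambda>t. \<nu> *\<^sub>R S e t) has_vector_derivative \<nu> *\<^sub>R S' e t) (at t within {t0..<T})"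
    by (rule bounded_linear.has_vector_derivative[OF bounded_linear_scaleR_right S_deriv[OF t]])
  from has_vector_derivative_add[OF p_deriv[OF t, of e] this] show ?thesis
    by (simp only: w_def[abs_def])
qed

lemma norm_S_le: "t \<in> {t0..<T} \<Longrightarrow> norm (S e t) \<le> norm e"
  using norm_weighted_le[of m e "q t", OF m] r_pos[of t]
  by (simp add: S_def z_def r_def[symmetric] field_simps)

lemma norm_p_le:
  assumes t: "t \<in> {t0..<T}"
  shows "norm (p e t) \<le> norm e * sqrt (2 * u t + 2 * h * r t)"
proof -
  have "norm (p e t) \<le> \<rho> t * (norm e * mass_norm m (q' t))"
    using norm_weighted_le[of m e "q' t", OF m] \<rho>_pos[OF t]
    by (simp add: p_def z'_def mult_left_mono)
  also have "\<dots> = norm e * sqrt (2 * u t + 2 * h * r t)"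
    by (simp add: \<rho>_def mass_norm_def real_sqrt_mult flip: energy[OF t])
  finally show ?thesis .
qed

lemma z'_weight_orth:
  assumes t: "t \<in> {t0..<T}"
  shows "z' e t \<in> weight_orth m"
proof -
  define f where "f z = (\<Sum>a\<in>UNIV. sqrt (m a) * z $ a)" for z :: "real^('n::{finite,linorder})"
  have "bounded_linear f"
    unfolding f_def by (intro bounded_linear_sum bounded_linear_const_mult bounded_linear_vec_nth)
  from bounded_linear.has_vector_derivative[OF this z_deriv[OF t, of e]]
  have "((\<lambda>t. f (z e t)) has_vector_derivative f (z' e t)) (at t within {t0..<T})" .
  moreover have "f (z e s) = 0" if "s \<in> {t0..<T}" for s
    using weighted_centered[OF centered[OF that] m, of e] by (simp add: f_def z_def weight_orth_def)
  then have "((\<lambda>t. 0) has_vector_derivative f (z' e t)) (at t within {t0..<T})"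
    using has_vector_derivative_transform[OF t _ calculation, of "\<lambda>t. 0"] by simp
  moreover have "at t within {t0..<T} \<noteq> bot"
    unfolding trivial_limit_within not_not
    by (rule islimpt_subset[OF islimpt_greaterThanLessThan1[of t T]]) (use t in auto)
  ultimately have "f (z' e t) = 0"
    using vector_derivative_unique_within[of t "{t0..<T}" "\<lambda>t. 0" "f (z' e t)" 0] by simp
  then show ?thesis by (simp add: f_def weight_orth_def)
qed

lemma S_w_weight_orth:
  assumes t: "t \<in> {t0..<T}"
  shows "S e t \<in> weight_orth m" "w e t \<in> weight_orth m"
proof -
  have z: "z e t \<in> weight_orth m" unfolding z_def by (rule weighted_centered[OF centered[OF t] m])
  note sub = subspace_weight_orth[of m]
  show S: "S e t \<in> weight_orth m" unfolding S_def by (rule subspace_scale[OF sub z])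
  show "w e t \<in> weight_orth m" unfolding w_def p_def
    by (intro subspace_add[OF sub] subspace_scale[OF sub] S z'_weight_orth[OF t])
qed

text \<open>The equations for \<open>S\<close> and \<open>w\<close> have the form required by
  \<open>fast_mode_vanishing\<close>, up to errors caused by \<open>v + \<nu>\<close> and by the
  difference of the kernels. Neither depends on \<open>e\<close>, so one \<open>t1\<close> serves
  all directions.\<close>

lemma slow_component_vanishes:
  assumes kern: "\<And>a b. ((\<lambda>t. kernel (q t /\<^sub>R r t) a b) \<longlongrightarrow> k a b) (at_left T)"
    and k: "\<And>a b. k a b = k b a"
    and c: "norm c = 1" "c \<in> weight_orth m" "pair_op m k c = - \<Lambda> *\<^sub>R c"
    and \<delta>: "\<delta> > 0" "\<And>y. y \<in> weight_orth m \<Longrightarrow> y \<bullet> c = 0 \<Longrightarrow>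
        \<delta> * (norm y)\<^sup>2 \<le> - (\<Lambda> *\<^sub>R y + pair_op m k y) \<bullet> y"
  obtains t1 where "t1 \<in> {t0..<T}"
    "\<And>e. S e t1 \<bullet> c = 2 / \<nu> * (w e t1 \<bullet> c) \<Longrightarrow> S e t1 = 0 \<and> w e t1 = 0"
proof -
  define C where "C x = - (\<Lambda> *\<^sub>R x + pair_op m k x)" for x
  have lin: "linear C"
    unfolding C_def by (intro linear_compose_neg linear_compose_add linear_pair_op linear_scale_self)
  have sym: "C x \<bullet> y = x \<bullet> C y" for x y
    using pair_op_self_adjoint[of m k x y, OF m k] by (simp add: C_def inner_diff_left inner_diff_right)
  have Cc: "C c = 0" by (simp add: C_def c)
  obtain \<eta> where \<eta>: "\<eta> > 0" and vanish: "\<And>t1 T S u S' u' R K M. \<lbrakk>t1 < (T::real);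
        \<And>t. t \<in> {t1..<T} \<Longrightarrow> (S has_vector_derivative S' t) (at t within {t1..<T});
        \<And>t. t \<in> {t1..<T} \<Longrightarrow> (u has_vector_derivative u' t) (at t within {t1..<T});
        \<And>t. t \<in> {t1..<T} \<Longrightarrow> S t \<in> weight_orth m; \<And>t. t \<in> {t1..<T} \<Longrightarrow> u t \<in> weight_orth m;
        continuous_on {t1..<T} R; \<And>t. t \<in> {t1..<T} \<Longrightarrow> 0 < R t; 0 < K;
        \<And>t. t \<in> {t1..<T} \<Longrightarrow> R t \<le> K * (T - t);
        \<And>t. t \<in> {t1..<T} \<Longrightarrow> norm (R t *\<^sub>R S' t - u t) \<le> \<eta> * (norm (S t) + norm (u t));
        \<And>t. t \<in> {t1..<T} \<Longrightarrow>
          norm (R t *\<^sub>R u' t - ((\<nu> / 2) *\<^sub>R u t - C (S t))) \<le> \<eta> * (norm (S t) + norm (u t));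
        \<And>t. t \<in> {t1..<T} \<Longrightarrow> norm (S t) \<le> M; \<And>t. t \<in> {t1..<T} \<Longrightarrow> norm (u t) \<le> M;
        S t1 \<bullet> c = 2 / \<nu> * (u t1 \<bullet> c)\<rbrakk> \<Longrightarrow> S t1 = 0 \<and> u t1 = 0"
    by (rule fast_mode_vanishing[OF lin[unfolded linear_conv_bounded_linear] sym Cc c(1)
          subspace_weight_orth c(2) \<delta>(1) _ \<nu>(1)]) (use \<delta>(2) in \<open>auto simp: C_def\<close>)
  define \<kappa> where "\<kappa> t = pair_bound m (\<lambda>a b. kernel (q t /\<^sub>R r t) a b - k a b)" for t
  have "(\<kappa> \<longlongrightarrow> pair_bound m (\<lambda>a b. k a b - k a b)) (at_left T)"
    unfolding \<kappa>_def pair_bound_def by (intro tendsto_intros kern)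
  then have "(\<kappa> \<longlongrightarrow> 0) (at_left T)" by (simp add: pair_bound_def)
  then have ev1: "\<forall>\<^sub>F t in at_left T. \<kappa> t < \<eta> / 2" using \<eta> by (intro order_tendstoD) auto
  \<comment> \<open>The factor \<open>1 + 2 * \<nu>\<close> makes both \<open>v + \<nu>\<close> and
    its product with \<nu> small, as the two equations require. Half of \<eta> is left for the
    kernels.\<close>
  have "((\<lambda>t. \<bar>v t + \<nu>\<bar> * (1 + 2 * \<nu>)) \<longlongrightarrow> \<bar>- \<nu> + \<nu>\<bar> * (1 + 2 * \<nu>)) (at_left T)"
    by (intro tendsto_intros v_tendsto)
  then have ev2: "\<forall>\<^sub>F t in at_left T. \<bar>v t + \<nu>\<bar> * (1 + 2 * \<nu>) < \<eta> / 2"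
    using \<eta> by (intro order_tendstoD) auto
  have ev3: "\<forall>\<^sub>F t in at_left T. 2 * u t + 2 * h * r t < \<nu>\<^sup>2 + 1"
    by (rule order_tendstoD(2)[OF energy_tendsto]) simp
  have ev4: "\<forall>\<^sub>F t in at_left T. \<bar>v t\<bar> < \<nu> + 1" by (rule abs_v_eventually_less) simp
  obtain t1 where t1: "t1 \<in> {t0..<T}" and ev: "\<And>t. t \<in> {t1..<T} \<Longrightarrow>
      (\<kappa> t < \<eta> / 2 \<and> \<bar>v t + \<nu>\<bar> * (1 + 2 * \<nu>) < \<eta> / 2) \<and>
      (2 * u t + 2 * h * r t < \<nu>\<^sup>2 + 1 \<and> \<bar>v t\<bar> < \<nu> + 1)"
    by (rule eventually_at_left_interval[OF t0
          eventually_conj[OF eventually_conj[OF ev1 ev2] eventually_conj[OF ev3 ev4]]]) blast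
  have I: "t \<in> {t0..<T}" if "t \<in> {t1..<T}" for t using that t1 by auto
  have sub: "{t1..<T} \<subseteq> {t0..<T}" using t1 by auto
  show thesis
  proof (rule that[OF t1])
    fix e assume init: "S e t1 \<bullet> c = 2 / \<nu> * (w e t1 \<bullet> c)"
    show "S e t1 = 0 \<and> w e t1 = 0"
    \<comment> \<open>The first two terms of the last argument bound \<open>p\<close> and
      \<open>\<nu> *\<^sub>R S\<close>, hence \<open>w\<close>; the third bounds
      \<open>S\<close>.\<close>
    proof (rule vanish[of t1 T "S e" "S' e" "w e" "\<lambda>t. p' e t + \<nu> *\<^sub>R S' e t" R "3 / 2 * (\<nu> + 1)"
          "norm e * sqrt (\<nu>\<^sup>2 + 1) + \<nu> * norm e + norm e"])
      show "t1 < T" using t1 by simp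
      show "continuous_on {t1..<T} R" by (rule R_continuous[OF sub])
      show "0 < 3 / 2 * (\<nu> + 1)" using \<nu>(1) by simp
      show "S e t1 \<bullet> c = 2 / \<nu> * (w e t1 \<bullet> c)" by (rule init)
      fix t assume t: "t \<in> {t1..<T}"
      show "(S e has_vector_derivative S' e t) (at t within {t1..<T})"
        by (rule has_vector_derivative_within_subset[OF S_deriv[OF I[OF t]] sub])
      show "(w e has_vector_derivative p' e t + \<nu> *\<^sub>R S' e t) (at t within {t1..<T})"
        by (rule has_vector_derivative_within_subset[OF w_deriv[OF I[OF t]] sub])
      show "S e t \<in> weight_orth m" "w e t \<in> weight_orth m" by (rule S_w_weight_orth[OF I[OF t]])+
      show "0 < R t" by (rule R_pos[OF I[OF t]])
      show "R t \<le> 3 / 2 * (\<nu> + 1) * (T - t)"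
      proof (rule R_le[OF t1 _ t])
        show "- (\<nu> + 1) \<le> v s" if "s \<in> {t1..<T}" for s using ev[OF that] by linarith
      qed
      have R0: "R t \<noteq> 0" using R_pos[OF I[OF t]] by simp
      have RS: "R t *\<^sub>R S' e t = p e t - v t *\<^sub>R S e t" using R0 by (simp add: S'_def)
      have Rp: "R t *\<^sub>R p' e t = (v t / 2) *\<^sub>R p e t + pair_op m (kernel (q t /\<^sub>R r t)) (S e t)"
        using R0 by (simp add: p'_def)
      have p: "p e t = w e t - \<nu> *\<^sub>R S e t" by (simp add: w_def)
      define d where "d = v t + \<nu>"
      have v: "v t = d - \<nu>" by (simp add: d_def)
      have d: "\<bar>d\<bar> * (1 + 2 * \<nu>) < \<eta> / 2" and \<kappa>: "\<kappa> t < \<eta> / 2" using ev[OF t] by (simp_all add: d_def)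
      have d\<nu>: "0 \<le> \<bar>d\<bar> * \<nu>" using \<nu>(1) by simp
      have d1: "\<bar>d\<bar> \<le> \<eta> / 2" "\<bar>d\<bar> * \<nu> \<le> \<eta> / 4" using d d\<nu> by (auto simp: distrib_left)
      have "norm (R t *\<^sub>R S' e t - w e t) = \<bar>d\<bar> * norm (S e t)"
      proof -
        have "R t *\<^sub>R S' e t - w e t = (- d) *\<^sub>R S e t" unfolding RS p v by (simp add: algebra_simps)
        then show ?thesis by simp
      qed
      also have "\<dots> \<le> \<eta> * norm (S e t)" using d1 \<eta> by (intro mult_right_mono) auto
      also have "\<dots> \<le> \<eta> * (norm (S e t) + norm (w e t))" using \<eta> by (intro mult_left_mono) auto
      finally show "norm (R t *\<^sub>R S' e t - w e t) \<le> \<eta> * (norm (S e t) + norm (w e t))" .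
      define B where "B = pair_op m (\<lambda>a b. kernel (q t /\<^sub>R r t) a b - k a b) (S e t)"
      have B: "norm B \<le> \<eta> / 2 * norm (S e t)"
      proof -
        have "norm B \<le> \<kappa> t * norm (S e t)" unfolding B_def \<kappa>_def by (rule norm_pair_op_le[OF m])
        also have "\<dots> \<le> \<eta> / 2 * norm (S e t)" using \<kappa> by (intro mult_right_mono) auto
        finally show ?thesis .
      qed
      have "R t *\<^sub>R (p' e t + \<nu> *\<^sub>R S' e t) - ((\<nu> / 2) *\<^sub>R w e t - C (S e t))
          = (d / 2) *\<^sub>R w e t - (3 / 2 * (d * \<nu>)) *\<^sub>R S e t + B"
      proof -
        have K: "pair_op m (kernel (q t /\<^sub>R r t)) (S e t) = B + pair_op m k (S e t)"
          unfolding B_def by (simp flip: pair_op_diff_kernel)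
        have \<Lambda>_eq: "\<nu> * \<nu> / 2 = \<Lambda>" using \<nu>(2) by (simp add: power2_eq_square)
        \<comment> \<open>With \<open>d = 0\<close> and \<open>Z = 0\<close> this is the limit
          equation: the two terms in \<nu> acting on \<open>W\<close> add up to
          \<open>\<nu> / 2\<close>, and \<open>\<nu> * \<nu> / 2 = \<Lambda>\<close> completes the
          operator \<open>C\<close>.\<close>
        have collect: "((d - \<nu>) / 2) *\<^sub>R (W - \<nu> *\<^sub>R X) + (Z + Y) + \<nu> *\<^sub>R ((W - \<nu> *\<^sub>R X) - (d - \<nu>) *\<^sub>R X)
            - ((\<nu> / 2) *\<^sub>R W - - ((\<nu> * \<nu> / 2) *\<^sub>R X + Y))
          = (d / 2) *\<^sub>R W - (3 / 2 * (d * \<nu>)) *\<^sub>R X + Z" for W X Y Z :: "real^('n::{finite,linorder})"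
          unfolding vec_eq_iff by (simp add: field_simps)
        have "R t *\<^sub>R (p' e t + \<nu> *\<^sub>R S' e t) = R t *\<^sub>R p' e t + \<nu> *\<^sub>R (R t *\<^sub>R S' e t)"
          by (simp only: scaleR_add_right scaleR_left_commute)
        also have "\<dots> - ((\<nu> / 2) *\<^sub>R w e t - C (S e t))
          = (d / 2) *\<^sub>R w e t - (3 / 2 * (d * \<nu>)) *\<^sub>R S e t + B"
          unfolding RS Rp p v K C_def by (rule collect[unfolded \<Lambda>_eq])
        finally show ?thesis .
      qed
      also have "norm \<dots> \<le> norm ((d / 2) *\<^sub>R w e t) + norm ((3 / 2 * (d * \<nu>)) *\<^sub>R S e t) + norm B"
        by (intro order_trans[OF norm_triangle_ineq] add_mono norm_triangle_ineq4 order_refl)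
      also have "\<dots> = \<bar>d\<bar> / 2 * norm (w e t) + 3 / 2 * (\<bar>d\<bar> * \<nu>) * norm (S e t) + norm B"
        using \<nu>(1) by (simp add: abs_mult)
      also have "\<dots> \<le> \<eta> * norm (w e t) + \<eta> / 2 * norm (S e t) + \<eta> / 2 * norm (S e t)"
      proof (intro add_mono mult_right_mono B)
        show "\<bar>d\<bar> / 2 \<le> \<eta>" using d1(1) \<eta> by linarith
        show "3 / 2 * (\<bar>d\<bar> * \<nu>) \<le> \<eta> / 2" using d1(2) \<eta> by linarith
      qed auto
      finally show "norm (R t *\<^sub>R (p' e t + \<nu> *\<^sub>R S' e t) - ((\<nu> / 2) *\<^sub>R w e t - C (S e t)))
          \<le> \<eta> * (norm (S e t) + norm (w e t))"
        by (simp add: algebra_simps)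
      have Se: "norm (S e t) \<le> norm e" by (rule norm_S_le[OF I[OF t]])
      have nn: "0 \<le> norm e * sqrt (\<nu>\<^sup>2 + 1)" "0 \<le> \<nu> * norm e" using \<nu>(1) by simp_all
      show "norm (S e t) \<le> norm e * sqrt (\<nu>\<^sup>2 + 1) + \<nu> * norm e + norm e" using Se nn by linarith
      have "norm (p e t) \<le> norm e * sqrt (\<nu>\<^sup>2 + 1)"
        using norm_p_le[OF I[OF t], of e] ev[OF t]
        by (elim order_trans) (intro mult_left_mono real_sqrt_le_mono, auto)
      moreover have "norm (\<nu> *\<^sub>R S e t) \<le> \<nu> * norm e" using Se \<nu>(1) by simp
      ultimately show "norm (w e t) \<le> norm e * sqrt (\<nu>\<^sup>2 + 1) + \<nu> * norm e + norm e"
        using norm_triangle_ineq[of "p e t" "\<nu> *\<^sub>R S e t"] norm_ge_zero[of e] unfolding w_def by linarith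
    qed
  qed
qed

end


section \<open>Uniqueness for the linear equation and confinement to a line\<close>

context total_collapse
begin

text \<open>Gronwall for \<open>N\<close>, the sum of the squared norms of \<open>z\<close> and
  \<open>z'\<close>, in both time directions: \<open>t1\<close> lies close to the collapse, and the
  vanishing must reach back to \<open>t0\<close>.\<close>

lemma z_unique:
  assumes t1: "t1 \<in> {t0..<T}" and zero: "z e t1 = 0" "z' e t1 = 0" and t: "t \<in> {t0..<T}"
  shows "z e t = 0"
proof -
  define N where "N t = z e t \<bullet> z e t + z' e t \<bullet> z' e t" for t
  define N' where
    "N' t = 2 * (z e t \<bullet> z' e t) + 2 * (z' e t \<bullet> pair_op m (kernel (q t)) (z e t))" for t
  define g where "g t = 1 + pair_bound m (kernel (q t))" for t
  have N: "(N has_real_derivative N' s) (at s within {t0..<T})" if s: "s \<in> {t0..<T}" for s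
    unfolding N_def[abs_def]
    by (rule DERIV_cong[OF DERIV_add[OF
            has_real_derivative_inner[OF z_deriv[OF s] z_deriv[OF s]]
            has_real_derivative_inner[OF z'_deriv[OF s] z'_deriv[OF s]]]])
      (simp add: N'_def inner_commute[of "z' e s" "z e s"]
        inner_commute[of "pair_op m (kernel (q s)) (z e s)"])
  have bound: "\<bar>N' s\<bar> \<le> g s * N s" for s
  proof -
    define X Y \<kappa> where "X = norm (z e s)" and "Y = norm (z' e s)"
      and "\<kappa> = pair_bound m (kernel (q s))"
    have \<kappa>: "0 \<le> \<kappa>"
      unfolding \<kappa>_def pair_bound_def using m by (intro sum_nonneg mult_nonneg_nonneg) (auto simp: less_imp_le)
    have XY: "2 * (X * Y) \<le> X\<^sup>2 + Y\<^sup>2"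
      using zero_le_power2[of "X - Y"] by (simp add: power2_diff)
    have "\<bar>z' e s \<bullet> pair_op m (kernel (q s)) (z e s)\<bar> \<le> Y * norm (pair_op m (kernel (q s)) (z e s))"
      unfolding Y_def by (rule Cauchy_Schwarz_ineq2)
    also have "\<dots> \<le> Y * (\<kappa> * X)"
      unfolding \<kappa>_def X_def by (intro mult_left_mono norm_pair_op_le m) (simp add: Y_def)
    finally have "\<bar>N' s\<bar> \<le> 2 * (X * Y) + \<kappa> * (2 * (X * Y))"
      using Cauchy_Schwarz_ineq2[of "z e s" "z' e s"]
      by (simp add: N'_def X_def[symmetric] Y_def[symmetric] mult_ac abs_le_iff)
    also have "\<dots> \<le> (X\<^sup>2 + Y\<^sup>2) + \<kappa> * (X\<^sup>2 + Y\<^sup>2)"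
      using XY \<kappa> by (intro add_mono mult_left_mono)
    also have "\<dots> = g s * N s"
      by (simp add: g_def N_def \<kappa>_def X_def Y_def power2_norm_eq_inner distrib_right)
    finally show ?thesis .
  qed
  have "continuous_on {t0..<T} q"
    using has_vector_derivative_continuous[OF dq] by (simp add: continuous_on_eq_continuous_within)
  have kcont: "continuous_on {t0..<T} (\<lambda>t. kernel (q t) a b)" for a b
  proof (cases "a = b")
    case False
    have "continuous_on {t0..<T} (\<lambda>t. 1 / norm (q t $ b - q t $ a) ^ 3)"
      using False coll_free
      by (intro continuous_intros \<open>continuous_on {t0..<T} q\<close> ballI power_not_zero)
        (auto simp: collision_free_def)
    then show ?thesis by (simp only: kernel_def)
  qed (simp add: kernel_def)
  have gcont: "continuous_on X g" if "X \<subseteq> {t0..<T}" for X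
    by (rule continuous_on_subset[OF _ that], unfold g_def pair_bound_def)
      (intro continuous_intros kcont)
  have N1: "N t1 = 0" by (simp add: N_def zero)
  have Nsub: "(N has_real_derivative N' s) (at s within X)" if "s \<in> X" "X \<subseteq> {t0..<T}" for s X
    by (rule DERIV_subset[OF N]) (use that in auto)
  have "N t \<le> 0"
  proof (cases "t1 \<le> t")
    case True
    have sub: "{t1..t} \<subseteq> {t0..<T}" using t t1 by auto
    have "\<exists>E>0. E * (- N t1) \<le> - N t"
    proof (rule gronwall_lower[where f = "\<lambda>s. - N s" and f' = "\<lambda>s. - N' s" and g = g])
      show "((\<lambda>s. - N s) has_real_derivative - N' s) (at s within {t1..t})" if "s \<in> {t1..t}" for s
        by (rule DERIV_minus[OF Nsub[OF that sub]])
      show "g s * - N s \<le> - N' s" for s using bound[of s] by (simp add: abs_le_iff)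
    qed (use True gcont[OF sub] in auto)
    then show ?thesis by (simp add: N1)
  next
    case False
    have sub: "{t..t1} \<subseteq> {t0..<T}" using t t1 by auto
    have "\<exists>E>0. E * N t \<le> N t1"
    proof (rule gronwall_lower[where f = N and f' = N' and g = "\<lambda>s. - g s"])
      show "(N has_real_derivative N' s) (at s within {t..t1})" if "s \<in> {t..t1}" for s
        by (rule Nsub[OF that sub])
      show "- g s * N s \<le> N' s" for s using bound[of s] by (simp add: abs_le_iff)
      show "continuous_on {t..t1} (\<lambda>s. - g s)" by (intro continuous_intros gcont sub)
    qed (use False in auto)
    then show ?thesis by (auto simp: N1 mult_le_0_iff)
  qed
  then have "z e t \<bullet> z e t \<le> 0" using inner_ge_zero[of "z' e t"] unfolding N_def by linarith
  then show ?thesis using inner_gt_zero_iff[of "z e t"] by linarith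
qed

text \<open>The vanishing condition is linear in \<open>e\<close>, hence of the form
  \<open>d \<bullet> e = 0\<close>; all bodies are orthogonal to every such \<open>e\<close> and so
  lie on the line through \<open>d\<close>.\<close>

lemma confined_to_line:
  assumes t1: "t1 \<in> {t0..<T}"
    and vanish: "\<And>e. S e t1 \<bullet> c = 2 / \<nu> * (w e t1 \<bullet> c) \<Longrightarrow> S e t1 = 0 \<and> w e t1 = 0"
  obtains d where "d \<noteq> 0" "\<And>t a. t \<in> {t0..<T} \<Longrightarrow> q t $ a \<in> span {d}"
proof -
  \<comment> \<open>\<open>A x\<close> is the vector representing the functional
    \<open>e \<mapsto> weighted m e x \<bullet> c\<close>; \<open>d\<close> is assembled from it by
    expanding \<open>S\<close> and \<open>w\<close> at \<open>t1\<close>.\<close>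
  define A where "A x = (\<Sum>a\<in>UNIV. (sqrt (m a) * c $ a) *\<^sub>R x $ a)"
    for x :: "real^'d^('n::{finite,linorder})"
  have A: "weighted m e x \<bullet> c = A x \<bullet> e" for e x
    by (simp add: A_def weighted_def inner_vec_def[of _ c] inner_sum_left mult_ac)
  define d where "d = (1 / r t1) *\<^sub>R A (q t1)
      - (2 / \<nu>) *\<^sub>R (\<rho> t1 *\<^sub>R A (q' t1) + (\<nu> / r t1) *\<^sub>R A (q t1))"
  have pos: "r t1 \<noteq> 0" "\<rho> t1 \<noteq> 0" using r_pos[OF t1] \<rho>_pos[OF t1] by auto
  have orth: "q t $ a \<bullet> e = 0" if e: "d \<bullet> e = 0" and t: "t \<in> {t0..<T}" for e t a
  proof -
    have "S e t1 \<bullet> c - 2 / \<nu> * (w e t1 \<bullet> c) = d \<bullet> e"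
      by (simp add: S_def w_def p_def z_def z'_def d_def inner_add_left inner_diff_left A)
    then have Sw: "S e t1 = 0" "w e t1 = 0" using vanish[of e] e by simp_all
    then have "z e t1 = 0" "z' e t1 = 0" using pos by (simp_all add: S_def w_def p_def)
    from z_unique[OF t1 this t] have "weighted m e (q t) $ a = 0" by (simp add: z_def)
    then show ?thesis using m[of a] by (simp add: weighted_def)
  qed
  show thesis
  proof (cases "d = 0")
    \<comment> \<open>If the functional is zero, every direction is admissible and all positions
      vanish, so an arbitrary coordinate axis serves.\<close>
    case True
    have "q t $ a \<bullet> q t $ a = 0" if "t \<in> {t0..<T}" for t a
      by (rule orth[OF _ that]) (simp add: True)
    then show thesis
      by (intro that[of "axis undefined 1"]) (auto simp: axis_eq_0_iff span_zero)
  next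
    case False
    show thesis
    proof (rule that[OF False])
      fix t a assume t: "t \<in> {t0..<T}"
      define k where "k = (q t $ a \<bullet> d) / (d \<bullet> d)"
      \<comment> \<open>The part of a position orthogonal to \<open>d\<close> is itself an
        admissible direction, so the position is orthogonal to it and it vanishes.\<close>
      define e where "e = q t $ a - k *\<^sub>R d"
      have de: "d \<bullet> e = 0" using False by (simp add: e_def k_def inner_diff_right inner_commute[of d "q t $ a"])
      have "e \<bullet> e = q t $ a \<bullet> e - k * (d \<bullet> e)" by (subst (1) e_def) (simp add: inner_diff_left)
      also have "\<dots> = 0" using orth[OF de t] de by simp
      finally have "q t $ a = k *\<^sub>R d" by (simp add: e_def)
      then show "q t $ a \<in> span {d}" by (simp add: span_base span_scale)
    qed
  qed
qed

end

section \<open>The collinear limiting shape and the conclusion\<close>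

lemma collinear_config_decompose:
  fixes s :: "real^'d^'n"
  assumes "collinear_config s"
  obtains \<omega> where "norm \<omega> = 1" "\<And>a. s $ a = (s $ a \<bullet> \<omega>) *\<^sub>R \<omega>"
proof -
  let ?V = "span (range (\<lambda>a. s $ a))"
  obtain B where B: "B \<subseteq> ?V" "independent B" "?V \<subseteq> span B" "card B = dim ?V"
    by (rule basis_exists)
  then obtain b where b: "B = {b}" using assms by (auto simp: collinear_config_def card_1_singleton_iff)
  then have b0: "b \<noteq> 0" using B(2) dependent_zero[of B] by auto
  define \<omega> where "\<omega> = b /\<^sub>R norm b"
  have \<omega>: "norm \<omega> = 1" using b0 by (simp add: \<omega>_def)
  show thesis
  proof (rule that[OF \<omega>])
    fix a
    have "s $ a \<in> span {b}" using B(3) b by (auto intro: span_base)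
    then obtain k where "s $ a = k *\<^sub>R b" by (auto simp: span_singleton)
    then have "s $ a = (k * norm b) *\<^sub>R \<omega>" using b0 by (simp add: \<omega>_def)
    then show "s $ a = (s $ a \<bullet> \<omega>) *\<^sub>R \<omega>" using \<omega> by (simp add: norm_eq_1)
  qed
qed

lemma newton_U_pos:
  fixes q :: "real^'d^('n::{finite,linorder})" and a0 b0 :: 'n
  assumes m: "\<And>a. m a > 0" and q: "collision_free q" and ab: "a0 \<noteq> b0"
  shows "0 < newton_U m q"
proof -
  have nonneg: "0 \<le> m a * m b / norm (q $ a - q $ b)" for a b
    using m[of a] m[of b] by simp
  have "0 < m a0 * m b0 / norm (q $ a0 - q $ b0)"
    using m[of a0] m[of b0] q ab by (simp add: collision_free_def)
  then have "0 < (\<Sum>b\<in>UNIV. m a0 * m b / norm (q $ a0 - q $ b))"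
    using nonneg by (intro sum_pos2[of UNIV b0 "\<lambda>b. m a0 * m b / norm (q $ a0 - q $ b)"]) auto
  then have "0 < (\<Sum>a\<in>UNIV. \<Sum>b\<in>UNIV. m a * m b / norm (q $ a - q $ b))"
    using nonneg
    by (intro sum_pos2[of UNIV a0 "\<lambda>a. \<Sum>b\<in>UNIV. m a * m b / norm (q $ a - q $ b)"] sum_nonneg) auto
  then show ?thesis by (simp add: newton_U_double)
qed

theorem theorem1p2:
  fixes m :: "'n::{finite,linorder} \<Rightarrow> real"
    and q :: "real \<Rightarrow> real^'d^('n::{finite,linorder})"
    and s0 :: "real^'d^('n::{finite,linorder})"
    and t0 T :: real
  assumes "\<And>a. m a > 0"
    and "total_collision_solution m t0 T q"
    and "has_limiting_shape m T q s0"
    and "collinear_config s0"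
  shows "\<exists>L :: (real^'d) set. affine L \<and> aff_dim L = 1 \<and>
           (\<forall>t\<in>{t0..<T}. \<forall>a. q t $ a \<in> L)"
proof -
  note m = assms(1)
  have T: "t0 < T" "(q \<longlongrightarrow> 0) (at_left T)" and sol: "newton_solution m {t0..<T} q"
    using assms(2) by (auto simp: total_collision_solution_def)
  have cen: "q t \<in> centered m" and cf: "collision_free (q t)" if "t \<in> {t0..<T}" for t
    using sol that by (auto simp: newton_solution_def)
  obtain q' where q': "\<forall>t\<in>{t0..<T}. (q has_vector_derivative q' t) (at t within {t0..<T}) \<and>
      (\<exists>g. has_mass_gradient m (newton_U m) g (q t) \<and> (q' has_vector_derivative g) (at t within {t0..<T}))"
    using sol by (auto simp: newton_solution_def)
  have dq': "(q' has_vector_derivative newton_force m (q t)) (at t within {t0..<T})"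
    if t: "t \<in> {t0..<T}" for t
  proof -
    obtain g where g: "has_mass_gradient m (newton_U m) g (q t)"
        "(q' has_vector_derivative g) (at t within {t0..<T})"
      using q' t by blast
    have "g = newton_force m (q t)"
      by (rule has_mass_gradient_unique[OF m g(1) has_mass_gradient_newton_U[OF cf[OF t]]])
    with g(2) show ?thesis by simp
  qed
  have cc: "normalized_CC m s0"
    and lim: "((\<lambda>t. mass_infdist m (q t /\<^sub>R mass_norm m (q t)) (rotation_orbit s0)) \<longlongrightarrow> 0) (at_left T)"
    using assms(3) by (auto simp: has_limiting_shape_def)
  have s0: "s0 \<in> centered m" "mass_inner m s0 s0 = 1" "collision_free s0"
    using cc by (auto simp: normalized_CC_def unit_configs_def mass_norm_def)
  obtain \<omega> where \<omega>: "norm \<omega> = 1" and s0_eq: "\<And>a. s0 $ a = (s0 $ a \<bullet> \<omega>) *\<^sub>R \<omega>"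
    by (rule collinear_config_decompose[OF assms(4)]) (rule that)
  \<comment> \<open>A single centered body would sit at the origin, against norm 1. With two bodies
    the potential is positive and a collision-free configuration is nonzero.\<close>
  obtain a0 b0 :: 'n where ab: "a0 \<noteq> b0"
  proof (rule ccontr)
    assume "\<not> thesis"
    then have single: "a = b" for a b :: 'n using that by blast
    have "s0 $ a = 0" for a
    proof -
      have "UNIV = {a}" using single by blast
      have "(\<Sum>a\<in>UNIV. m a *\<^sub>R s0 $ a) = 0" using s0(1) by (simp add: centered_def)
      then have "m a *\<^sub>R s0 $ a = 0" unfolding \<open>UNIV = {a}\<close> by simp
      then show ?thesis using m[of a] by simp
    qed
    then show False using s0(2) by (simp add: mass_inner_def)
  qed
  define \<Lambda> where "\<Lambda> = newton_U m s0"
  have \<Lambda>: "0 < \<Lambda>" unfolding \<Lambda>_def by (rule newton_U_pos[OF m s0(3) ab])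
  interpret total_collapse m q q' t0 T \<Lambda>
  proof
    show "q t \<noteq> 0" if "t \<in> {t0..<T}" for t
      using cf[OF that] ab by (auto simp: collision_free_def)
    show "((\<lambda>t. newton_U m (q t /\<^sub>R mass_norm m (q t))) \<longlongrightarrow> \<Lambda>) (at_left T)"
      unfolding \<Lambda>_def by (rule limiting_shape_kernel(2)[OF m s0(3) lim])
  qed (use m T cen cf q' dq' \<Lambda> in auto)
  define \<gamma> where "\<gamma> a = s0 $ a \<bullet> \<omega>" for a
  define c where "c = weighted m \<omega> s0"
  have c_eq: "c = (\<chi> a. sqrt (m a) * \<gamma> a)" by (simp add: c_def weighted_def \<gamma>_def)
  have s0\<gamma>: "s0 $ a = \<gamma> a *\<^sub>R \<omega>" for a using s0_eq[of a] by (simp add: \<gamma>_def)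
  have inj: "inj \<gamma>"
    using s0(3) by (intro injI) (metis collision_free_def s0\<gamma>)
  have kern: "kernel s0 a b = 1 / \<bar>\<gamma> b - \<gamma> a\<bar> ^ 3" for a b
    unfolding kernel_def s0\<gamma> by (simp add: \<omega> flip: scaleR_diff_left)
  have c_cen: "(\<Sum>a\<in>UNIV. m a * \<gamma> a) = 0"
  proof -
    have "(\<Sum>a\<in>UNIV. m a * \<gamma> a) = (\<Sum>a\<in>UNIV. m a *\<^sub>R s0 $ a) \<bullet> \<omega>"
      by (simp add: \<gamma>_def inner_sum_left)
    then show ?thesis using s0(1) by (simp add: centered_def)
  qed
  have "c \<bullet> c = mass_inner m s0 s0"
    unfolding mass_inner_def inner_vec_def[of c] unfolding c_eq
  proof (intro sum.cong refl)
    show "(\<chi> a. sqrt (m a) * \<gamma> a) $ a \<bullet> (\<chi> a. sqrt (m a) * \<gamma> a) $ a = m a * (s0 $ a \<bullet> s0 $ a)" for a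
      using m[of a] \<omega> by (simp add: s0\<gamma> norm_eq_1 power_mult_distrib flip: power2_eq_square)
  qed
  then have c1: "norm c = 1" using s0(2) by (simp add: norm_eq_1)
  have c_orth: "c \<in> weight_orth m" unfolding c_def by (rule weighted_centered[OF s0(1) m])
  \<comment> \<open>The central configuration equation read along \<omega>.\<close>
  have c_eig: "pair_op m (kernel s0) c = - \<Lambda> *\<^sub>R c"
    unfolding c_def weighted_newton_force[of m, OF m, symmetric] normalized_CC_newton_force[OF m cc] \<Lambda>_def
    using linear_scale[OF bounded_linear.linear[OF bounded_linear_weighted]] .
  obtain \<delta> where \<delta>: "\<delta> > 0"
    "\<And>y. y \<in> weight_orth m \<Longrightarrow> y \<bullet> c = 0 \<Longrightarrow>
      \<delta> * (norm y)\<^sup>2 \<le> - (\<Lambda> *\<^sub>R y + pair_op m (kernel s0) y) \<bullet> y"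
    by (rule conley_coercive[OF m inj c_cen kern c_eq c_eig]) blast
  obtain t1 where t1: "t1 \<in> {t0..<T}"
    and vanish: "\<And>e. S e t1 \<bullet> c = 2 / \<nu> * (w e t1 \<bullet> c) \<Longrightarrow> S e t1 = 0 \<and> w e t1 = 0"
    by (rule slow_component_vanishes[OF _ kernel_sym c1 c_orth c_eig \<delta>])
      (use limiting_shape_kernel(1)[OF m s0(3) lim] in \<open>auto simp: r_def\<close>)
  obtain d where d: "d \<noteq> 0" "\<And>t a. t \<in> {t0..<T} \<Longrightarrow> q t $ a \<in> span {d}"
    by (rule confined_to_line[where c = c, OF t1 vanish]) (assumption, rule that)
  have "aff_dim (span {d}) = 1"
    using d(1) by (simp add: aff_dim_subspace)
  moreover have "affine (span {d})" by (simp add: subspace_imp_affine)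
  ultimately show ?thesis using d(2) by blast
qed

end
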